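(* There exist constants $\alpha,\epsilon>0$ (independent of $n$) and, for every positive integer $n$, a continuous map $\psi=\psi_n:S^n\to S^n$ that preserves antipodal points, such that if $X$ is a random linear subsphere of $S^n$ of dimension $\lfloor\alpha n\rfloor$, then with probability $1-o(1)$ as $n\to\infty$ the set $\psi(X)_\epsilon$ does not contain a great circle.
   Context: $S^n$ is the Euclidean unit sphere of $\mathbb{R}^{n+1}$. A map $\psi:S^n\to S^n$ preserves antipodal points if $\psi(-x)=-\psi(x)$ for all $x$. A linear subsphere of dimension $d$ of $S^n$ is the unit sphere $V\cap S^n$ of a $(d+1)$-dimensional linear subspace $V$ of $\mathbb{R}^{n+1}$; a random linear subsphere is one for which $V$ is distributed according to the rotation-invariant probability measure on the Grassmannian of $(d+1)$-dimensional subspaces. A great circle is a linear subsphere of dimension $1$. For $A\subset S^n$ and $\epsilon>0$, $A_\epsilon$ is the set of all points of $S^n$ at (Euclidean) distance at most $\epsilon$ from $A$. *)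

theory Defs
  imports "HOL-Probability.Probability" "HOL-Library.Function_Algebras"
begin

text \<open>
  Since the dimension varies inside the theorem, points of \<open>\<real>\<^sup>n\<^sup>+\<^sup>1\<close> are functions
  \<open>nat \<Rightarrow> real\<close> that vanish outside \<open>{..n}\<close>, as in the library's \<^const>\<open>Euclidean_space\<close>
  and \<^const>\<open>nsphere\<close>. With the pointwise vector space structure below, the library's
  \<^const>\<open>subspace\<close>, \<^const>\<open>dim\<close> and \<^const>\<open>linear\<close> apply to this type. The type-class
  metric on \<open>nat \<Rightarrow> real\<close> is not the Euclidean one and is not used.
\<close>

instantiation "fun" :: (type, real_vector) real_vector
begin

definition scaleR_fun :: "real \<Rightarrow> ('a \<Rightarrow> 'b) \<Rightarrow> 'a \<Rightarrow> 'b" where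
  "scaleR_fun c f = (\<lambda>x. c *\<^sub>R f x)"

instance
  by standard (auto simp: scaleR_fun_def fun_eq_iff scaleR_add_right scaleR_add_left)

end

definition inner_upto :: "nat \<Rightarrow> (nat \<Rightarrow> real) \<Rightarrow> (nat \<Rightarrow> real) \<Rightarrow> real" where
  "inner_upto n x y = (\<Sum>i\<le>n. x i * y i)"

definition dist_upto :: "nat \<Rightarrow> (nat \<Rightarrow> real) \<Rightarrow> (nat \<Rightarrow> real) \<Rightarrow> real" where
  "dist_upto n x y = L2_set (\<lambda>i. x i - y i) {..n}"

definition grassmannian :: "nat \<Rightarrow> nat \<Rightarrow> (nat \<Rightarrow> real) set set" where
  "grassmannian n k =
     {V. V \<subseteq> topspace (Euclidean_space (Suc n)) \<and> subspace V \<and> dim V = k}"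

definition great_circle :: "nat \<Rightarrow> (nat \<Rightarrow> real) set \<Rightarrow> bool" where
  "great_circle n C \<longleftrightarrow> (\<exists>V \<in> grassmannian n 2. C = V \<inter> topspace (nsphere n))"

definition nbhd :: "nat \<Rightarrow> real \<Rightarrow> (nat \<Rightarrow> real) set \<Rightarrow> (nat \<Rightarrow> real) set" where
  "nbhd n \<epsilon> A =
     {y \<in> topspace (nsphere n). A \<noteq> {} \<and> (INF a\<in>A. dist_upto n y a) \<le> \<epsilon>}"

definition orth_proj :: "nat \<Rightarrow> (nat \<Rightarrow> real) set \<Rightarrow> (nat \<Rightarrow> real) \<Rightarrow> nat \<Rightarrow> real" where
  "orth_proj n V x = (THE y. y \<in> V \<and> (\<forall>v\<in>V. inner_upto n (x - y) v = 0))"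

text \<open>
  The usual topology of the Grassmannian, obtained by identifying a subspace with the
  orthogonal projection onto it. The topology on maps is that of pointwise convergence,
  which on projections of a finite-dimensional space is the norm topology.
\<close>

definition grassmannian_topology :: "nat \<Rightarrow> nat \<Rightarrow> (nat \<Rightarrow> real) set topology" where
  "grassmannian_topology n k = pullback_topology (grassmannian n k) (orth_proj n) euclidean"

definition orthogonal_upto :: "nat \<Rightarrow> ((nat \<Rightarrow> real) \<Rightarrow> nat \<Rightarrow> real) \<Rightarrow> bool" where
  "orthogonal_upto n R \<longleftrightarrow>
     linear R \<and>
     (\<forall>x \<in> topspace (Euclidean_space (Suc n)). R x \<in> topspace (Euclidean_space (Suc n))) \<and>
     (\<forall>x \<in> topspace (Euclidean_space (Suc n)). \<forall>y \<in> topspace (Euclidean_space (Suc n)).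
        inner_upto n (R x) (R y) = inner_upto n x y)"

text \<open>
  A rotation-invariant Borel probability measure on the Grassmannian of \<open>k\<close>-dimensional
  subspaces of \<open>\<real>\<^sup>n\<^sup>+\<^sup>1\<close>. For \<open>k \<le> n + 1\<close> there is exactly one (for \<open>k > n + 1\<close> there is
  none, the Grassmannian being empty).
\<close>

definition rotation_invariant_prob ::
    "nat \<Rightarrow> nat \<Rightarrow> (nat \<Rightarrow> real) set measure \<Rightarrow> bool" where
  "rotation_invariant_prob n k M \<longleftrightarrow>
     prob_space M \<and>
     space M = grassmannian n k \<and>
     sets M = sigma_sets (grassmannian n k) {U. openin (grassmannian_topology n k) U} \<and>
     (\<forall>R. orthogonal_upto n R \<longrightarrow> distr M M ((`) R) = M)"

end

theory Submission
  imports Defs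
begin

text \<open>
  Write \<open>N = n + 1\<close>. The map \<open>\<psi>\<close> cuts every coordinate off at \<open>\<plusminus>1 / (m \<surd>N)\<close>, for a large
  constant \<open>m\<close>, and normalises. If only few coordinates of \<open>x\<close> are smaller than the cut-off, then
  \<open>\<psi> x\<close> is almost a vertex of the cube, so its \<open>\<ell>\<^sup>1\<close> norm is close to the maximal value \<open>\<surd>N\<close>.
  On a great circle the \<open>\<ell>\<^sup>1\<close> norm cannot stay close to \<open>\<surd>N\<close>: the average over the four
  directions \<open>u, v, (u \<plusminus> v) / \<surd>2\<close> is at most \<open>0.94 \<surd>N\<close>. Hence if a great circle lies near
  \<open>\<psi>(V \<inter> S\<^sup>n)\<close>, then \<open>V \<inter> S\<^sup>n\<close> contains a point with at least \<open>N / 100\<close> small coordinates.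

  Such points form a set covered by \<open>(12 m)^N / m^(N / 100)\<close> balls of radius \<open>2 / m\<close>. By
  invariance under reflections, the probability \<open>p\<close> that \<open>V\<close> passes within \<open>2 / m\<close> of a given
  point of the sphere does not depend on the point. The sphere carries a \<open>7 / m\<close>-separated set of at
  least \<open>(m / 320)\<^sup>n\<close> points, of which any \<open>k\<close>-dimensional \<open>V\<close> is near at most
  \<open>(5 * 2^m)^k\<close>, whence \<open>p \<le> (5 * 2^m)^k / (m / 320)^n\<close>. With \<open>m\<close> large and then
  \<open>k / n\<close> small, the union bound over the cover is exponentially small.
\<close>

section \<open>Counting integer vectors\<close>

text \<open>The positive and the negative \<open>j\<close> each contribute a geometric series of sum
  at most \<open>1 / (1 - t)\<close>, and \<open>j = 0\<close> contributes \<open>l\<close>. This is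
  the factor of a single coordinate in the count below.\<close>

lemma sum_power_nat_abs_le:
  fixes t :: real
  assumes "0 < t" "t < 1"
  shows "(\<Sum>j\<in>{- int T..int T}. t ^ nat \<bar>j\<bar> * (if j = 0 then l else 1)) \<le> 2 / (1 - t) + l"
proof -
  define f where "f = (\<lambda>j::int. t ^ nat \<bar>j\<bar> * (if j = 0 then l else 1))"
  have split: "{- int T..int T} = insert 0 ((\<lambda>k. int k) ` {1..T} \<union> (\<lambda>k. - int k) ` {1..T})"
  proof (intro equalityI subsetI)
    fix j assume j: "j \<in> {- int T..int T}"
    consider "j = 0" | "j > 0" | "j < 0" by linarith
    then show "j \<in> insert 0 ((\<lambda>k. int k) ` {1..T} \<union> (\<lambda>k. - int k) ` {1..T})"
    proof cases
      case 2
      then have "j = int (nat j)" "nat j \<in> {1..T}" using j by auto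
      then show ?thesis by blast
    next
      case 3
      then have "j = - int (nat (- j))" "nat (- j) \<in> {1..T}" using j by auto
      then show ?thesis by blast
    qed simp
  qed auto
  have geo: "(\<Sum>k\<in>{1..T}. t ^ k) \<le> 1 / (1 - t)"
  proof -
    have "(\<Sum>k\<in>{1..T}. t ^ k) \<le> (\<Sum>k<Suc T. t ^ k)"
      by (rule sum_mono2) (use assms in auto)
    also have "\<dots> = (1 - t ^ Suc T) / (1 - t)"
      using assms by (subst sum_gp_strict) auto
    also have "\<dots> \<le> 1 / (1 - t)"
      using assms by (intro divide_right_mono) auto
    finally show ?thesis .
  qed
  have "sum f {- int T..int T} = f 0 + (sum f ((\<lambda>k. int k) ` {1..T}) + sum f ((\<lambda>k. - int k) ` {1..T}))"
    unfolding split by (subst sum.insert, simp, force, subst sum.union_disjoint) auto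
  also have "sum f ((\<lambda>k. int k) ` {1..T}) = (\<Sum>k\<in>{1..T}. t ^ k)"
    by (subst sum.reindex) (auto simp: f_def inj_on_def intro!: sum.cong)
  also have "sum f ((\<lambda>k. - int k) ` {1..T}) = (\<Sum>k\<in>{1..T}. t ^ k)"
    by (subst sum.reindex) (auto simp: f_def inj_on_def intro!: sum.cong)
  also have "f 0 = l" by (simp add: f_def)
  finally show ?thesis using geo unfolding f_def by simp
qed

text \<open>
  Generating function bound: a vector \<open>a\<close> gets the weight \<open>\<Prod>i. t^\<bar>a i\<bar> * l^[a i = 0]\<close>,
  and the total weight of all integer vectors factorises.
\<close>

lemma card_int_vectors_le:
  fixes t l :: real
  assumes I: "finite I" and t: "0 < t" "t < 1" and l: "1 \<le> l"
    and ext: "A \<subseteq> extensional I"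
    and T: "\<And>a. a \<in> A \<Longrightarrow> (\<Sum>i\<in>I. \<bar>a i\<bar>) \<le> int T"
    and z: "\<And>a. a \<in> A \<Longrightarrow> z \<le> card {i \<in> I. a i = 0}"
  shows "finite A" "real (card A) * l ^ z * t ^ T \<le> (2 / (1 - t) + l) ^ card I"
proof -
  let ?B = "Pi\<^sub>E I (\<lambda>_. {- int T..int T})"
  let ?f = "\<lambda>j::int. t ^ nat \<bar>j\<bar> * (if j = 0 then l else 1)"
  have sub: "A \<subseteq> ?B"
  proof
    fix a assume a: "a \<in> A"
    have "\<bar>a i\<bar> \<le> int T" if "i \<in> I" for i
      using member_le_sum[of i I "\<lambda>i. \<bar>a i\<bar>"] T[OF a] that I by force
    then show "a \<in> ?B" using a ext by (force simp: PiE_def)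
  qed
  have finB: "finite ?B" using I by (intro finite_PiE) auto
  then show "finite A" using sub finite_subset by blast
  \<comment> \<open>Since \<open>t < 1\<close> and \<open>1 \<le> l\<close>, a vector of small l1
    norm with many zeros is heavy, so the total weight limits how many of them there are.\<close>
  have ge: "l ^ z * t ^ T \<le> (\<Prod>i\<in>I. ?f (a i))" if a: "a \<in> A" for a
  proof -
    have "int (\<Sum>i\<in>I. nat \<bar>a i\<bar>) \<le> int T"
      using T[OF a] by simp
    then have le: "(\<Sum>i\<in>I. nat \<bar>a i\<bar>) \<le> T" by linarith
    have "(\<Prod>i\<in>I. ?f (a i)) = (\<Prod>i\<in>I. t ^ nat \<bar>a i\<bar>) * (\<Prod>i\<in>I. if a i = 0 then l else 1)"
      by (rule prod.distrib)
    also have "(\<Prod>i\<in>I. if a i = 0 then l else 1) = l ^ card {i \<in> I. a i = 0}"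
      using I by (simp add: prod.inter_filter[symmetric])
    also have "(\<Prod>i\<in>I. t ^ nat \<bar>a i\<bar>) = t ^ (\<Sum>i\<in>I. nat \<bar>a i\<bar>)"
      by (simp add: power_sum)
    finally have eq: "(\<Prod>i\<in>I. ?f (a i)) = t ^ (\<Sum>i\<in>I. nat \<bar>a i\<bar>) * l ^ card {i \<in> I. a i = 0}" .
    have "t ^ T * l ^ z \<le> t ^ (\<Sum>i\<in>I. nat \<bar>a i\<bar>) * l ^ card {i \<in> I. a i = 0}"
      using t l le z[OF a] by (intro mult_mono power_decreasing power_increasing) auto
    then show ?thesis using eq by (simp add: mult.commute)
  qed
  have "real (card A) * l ^ z * t ^ T = (\<Sum>a\<in>A. l ^ z * t ^ T)" by simp
  also have "\<dots> \<le> (\<Sum>a\<in>A. \<Prod>i\<in>I. ?f (a i))" by (intro sum_mono ge)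
  also have "\<dots> \<le> (\<Sum>a\<in>?B. \<Prod>i\<in>I. ?f (a i))"
    using t l by (intro sum_mono2 finB sub prod_nonneg) auto
  also have "\<dots> = (\<Prod>i\<in>I. \<Sum>j\<in>{- int T..int T}. ?f j)"
    using I by (subst prod_sum_PiE) auto
  also have "\<dots> \<le> (\<Prod>i\<in>I. 2 / (1 - t) + l)"
    using t l sum_power_nat_abs_le[OF t] by (intro prod_mono conjI sum_nonneg) auto
  finally show "real (card A) * l ^ z * t ^ T \<le> (2 / (1 - t) + l) ^ card I" by simp
qed

text \<open>
  Rounding towards zero, so that absolute values do not grow and small coordinates become \<open>0\<close>; the
  price is that numbers with the same rounding may differ by up to \<open>2\<close>.
\<close>

definition trunc :: "real \<Rightarrow> int" where
  "trunc x = (if 0 \<le> x then \<lfloor>x\<rfloor> else \<lceil>x\<rceil>)"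

lemma abs_trunc_le: "real_of_int \<bar>trunc x\<bar> \<le> \<bar>x\<bar>"
proof (cases "0 \<le> x")
  case False
  then have "\<lceil>x\<rceil> \<le> 0" "x \<le> real_of_int \<lceil>x\<rceil>" by (auto simp: ceiling_le_iff)
  then show ?thesis using False by (simp add: trunc_def)
qed (simp add: trunc_def)

lemma trunc_eq_0: "\<bar>x\<bar> < 1 \<Longrightarrow> trunc x = 0"
  unfolding trunc_def by (auto simp: abs_if floor_eq_iff ceiling_eq_iff split: if_splits)

lemma trunc_sgn:
  "0 \<le> x \<Longrightarrow> 0 \<le> trunc x \<and> real_of_int (trunc x) \<le> x \<and> x < real_of_int (trunc x) + 1"
  "x \<le> 0 \<Longrightarrow> trunc x \<le> 0 \<and> x \<le> real_of_int (trunc x) \<and> real_of_int (trunc x) < x + 1"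
proof -
  show "0 \<le> x \<Longrightarrow> 0 \<le> trunc x \<and> real_of_int (trunc x) \<le> x \<and> x < real_of_int (trunc x) + 1"
    by (simp add: trunc_def)
  have "real_of_int \<lceil>x\<rceil> < x + 1" by linarith
  then show "x \<le> 0 \<Longrightarrow> trunc x \<le> 0 \<and> x \<le> real_of_int (trunc x) \<and> real_of_int (trunc x) < x + 1"
    by (cases "x = 0") (auto simp: trunc_def ceiling_le_iff)
qed

lemma trunc_eqD:
  assumes "trunc x = trunc y"
  shows "\<bar>x - y\<bar> \<le> 2"
proof -
  have j: "real_of_int (trunc x) = real_of_int (trunc y)" using assms by simp
  consider "0 \<le> x" "0 \<le> y" | "0 \<le> x" "y \<le> 0" | "x \<le> 0" "0 \<le> y" | "x \<le> 0" "y \<le> 0"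
    by linarith
  then show ?thesis
  proof cases
    case 1
    then show ?thesis using j trunc_sgn(1)[of x] trunc_sgn(1)[of y] by linarith
  next
    case 2
    then show ?thesis using j trunc_sgn(1)[of x] trunc_sgn(2)[of y] by linarith
  next
    case 3
    then show ?thesis using j trunc_sgn(2)[of x] trunc_sgn(1)[of y] by linarith
  next
    case 4
    then show ?thesis using j trunc_sgn(2)[of x] trunc_sgn(2)[of y] by linarith
  qed
qed

text \<open>Each coordinate differs by at most \<open>2 / (m * sqrt (card I))\<close>. The factor
  \<open>sqrt (card I)\<close> in the scale makes these errors add up to Euclidean distance
  \<open>2 / m\<close>, whatever the dimension.\<close>

lemma trunc_scaled_eqD:
  assumes "finite I" "I \<noteq> {}" "0 < m"
    and "\<And>i. i \<in> I \<Longrightarrow> trunc (f i * (m * sqrt (card I))) = trunc (g i * (m * sqrt (card I)))"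
  shows "(\<Sum>i\<in>I. (f i - g i)\<^sup>2) \<le> (2 / m)\<^sup>2"
proof -
  have c: "real (card I) > 0" using assms card_gt_0_iff by auto
  have "(f i - g i)\<^sup>2 \<le> (2 / m)\<^sup>2 / card I" if "i \<in> I" for i
  proof -
    have "\<bar>f i - g i\<bar> * (m * sqrt (card I)) \<le> 2"
      using trunc_eqD[OF assms(4)[OF that]] assms(3)
      by (simp add: abs_mult flip: left_diff_distrib)
    then have "(\<bar>f i - g i\<bar> * (m * sqrt (card I)))\<^sup>2 \<le> 2\<^sup>2"
      using assms(3) by (intro power_mono) auto
    then show ?thesis using assms(3) c by (simp add: power_mult_distrib field_simps)
  qed
  then have "(\<Sum>i\<in>I. (f i - g i)\<^sup>2) \<le> (\<Sum>i\<in>I. (2 / m)\<^sup>2 / card I)" by (intro sum_mono)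
  then show ?thesis using c by simp
qed

text \<open>Cauchy-Schwarz turns Euclidean radius \<open>r\<close> into l1 norm at most
  \<open>r * sqrt (card I)\<close>, and rounding towards zero cannot increase it. This supplies the
  l1 hypothesis of \<open>card_int_vectors_le\<close>.\<close>

lemma sum_abs_trunc_le:
  fixes m r :: nat
  assumes "(\<Sum>i\<in>I. (f i)\<^sup>2) \<le> (real r)\<^sup>2"
  shows "(\<Sum>i\<in>I. \<bar>trunc (f i * (m * sqrt (card I)))\<bar>) \<le> int (card I * r * m)"
proof -
  let ?q = "m * sqrt (card I)"
  have q: "?q \<ge> 0" by simp
  have "(\<Sum>i\<in>I. \<bar>f i\<bar>)\<^sup>2 \<le> (\<Sum>i\<in>I. \<bar>f i\<bar>\<^sup>2) * card I"
    by (rule sum_squared_le_sum_of_squares)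
  also have "\<dots> \<le> (real r)\<^sup>2 * card I" using assms by (intro mult_right_mono) auto
  also have "\<dots> = (r * sqrt (card I))\<^sup>2" by (simp add: power_mult_distrib)
  finally have s: "(\<Sum>i\<in>I. \<bar>f i\<bar>) \<le> r * sqrt (card I)" by (rule power2_le_imp_le) auto
  have "real_of_int (\<Sum>i\<in>I. \<bar>trunc (f i * ?q)\<bar>) = (\<Sum>i\<in>I. real_of_int \<bar>trunc (f i * ?q)\<bar>)" by simp
  also have "\<dots> \<le> (\<Sum>i\<in>I. \<bar>f i\<bar> * ?q)"
    using abs_trunc_le q by (intro sum_mono) (metis abs_mult abs_of_nonneg)
  also have "\<dots> = (\<Sum>i\<in>I. \<bar>f i\<bar>) * ?q" by (simp add: sum_distrib_right)
  also have "\<dots> \<le> (r * sqrt (card I)) * ?q" using s q by (rule mult_right_mono)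
  also have "\<dots> = real_of_int (int (card I * r * m))" by simp
  finally show ?thesis by (simp only: of_int_le_iff)
qed

text \<open>Take a separated subset of greatest cardinality. A point of \<open>X\<close> close to
  none of its members could be added, so the neighbourhoods of the members, each with at most
  \<open>b\<close> points, cover \<open>X\<close>.\<close>

lemma maximal_separated_subset:
  assumes "finite X" and sym: "\<And>x y. cl x y \<Longrightarrow> cl y x"
    and b: "\<And>z. z \<in> X \<Longrightarrow> card {x \<in> X. cl z x} \<le> b"
    and refl: "\<And>x. cl x x"
  obtains Z where "Z \<subseteq> X" "\<And>x y. x \<in> Z \<Longrightarrow> y \<in> Z \<Longrightarrow> x \<noteq> y \<Longrightarrow> \<not> cl x y"
    "card X \<le> card Z * b"
proof -
  let ?P = "\<lambda>Z. Z \<subseteq> X \<and> (\<forall>x\<in>Z. \<forall>y\<in>Z. x \<noteq> y \<longrightarrow> \<not> cl x y)"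
  have "?P {}" by simp
  moreover have "\<forall>Z. ?P Z \<longrightarrow> card Z < Suc (card X)"
    using card_mono[OF assms(1)] by (meson le_imp_less_Suc)
  ultimately have "\<exists>Z. ?P Z \<and> (\<forall>Y. ?P Y \<longrightarrow> card Y \<le> card Z)"
    by (rule ex_has_greatest_nat)
  then obtain Z where Zmax: "?P Z \<and> (\<forall>Y. ?P Y \<longrightarrow> card Y \<le> card Z)" by (rule exE)
  then have Z: "?P Z" by (rule conjunct1)
  have max: "card Y \<le> card Z" if "?P Y" for Y
    by (rule mp[OF spec[OF conjunct2[OF Zmax]] that])
  have finZ: "finite Z" using Z assms(1) finite_subset by blast
  have cov: "X \<subseteq> (\<Union>z\<in>Z. {x \<in> X. cl z x})"
  proof
    fix x assume x: "x \<in> X"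
    show "x \<in> (\<Union>z\<in>Z. {x \<in> X. cl z x})"
    proof (rule ccontr)
      assume n: "x \<notin> (\<Union>z\<in>Z. {x \<in> X. cl z x})"
      then have far: "\<not> cl z x" if "z \<in> Z" for z using that x by blast
      have "x \<notin> Z" using far refl by blast
      moreover have "?P (insert x Z)" using Z x far sym by blast
      ultimately show False using max[of "insert x Z"] finZ by simp
    qed
  qed
  have "card X \<le> card (\<Union>z\<in>Z. {x \<in> X. cl z x})"
    using cov finZ assms(1) by (intro card_mono) auto
  also have "\<dots> \<le> (\<Sum>z\<in>Z. card {x \<in> X. cl z x})" using finZ by (rule card_UN_le)
  also have "\<dots> \<le> (\<Sum>z\<in>Z. b)" using Z b by (intro sum_mono) blast
  finally have "card X \<le> card Z * b" by simp
  then show thesis using Z by (intro that[of Z]) simp_all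
qed

section \<open>Subspaces, projections and reflections\<close>

lemma sum_apply: "(\<Sum>i\<in>I. f i) x = (\<Sum>i\<in>I. f i x)" for f :: "'i \<Rightarrow> 'a \<Rightarrow> real"
  by (induction I rule: infinite_finite_induct) auto

lemma scaleR_fun_apply [simp]: "(c *\<^sub>R f) x = c * f x" for f :: "'a \<Rightarrow> real"
  by (simp add: scaleR_fun_def)

lemma mem_Euclidean_space: "x \<in> topspace (Euclidean_space (Suc n)) \<longleftrightarrow> (\<forall>i>n. x i = 0)"
  by (auto simp: topspace_Euclidean_space Suc_le_eq)

lemma mem_nsphere:
  "x \<in> topspace (nsphere n) \<longleftrightarrow> x \<in> topspace (Euclidean_space (Suc n)) \<and> inner_upto n x x = 1"
  by (auto simp: nsphere_def inner_upto_def power2_eq_square)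

lemma subspace_Euclidean_space: "subspace (topspace (Euclidean_space (Suc n)))"
  by (auto simp: subspace_def mem_Euclidean_space)

lemma inner_upto_commute: "inner_upto n x y = inner_upto n y x"
  by (simp add: inner_upto_def mult.commute)

lemma inner_upto_add_left: "inner_upto n (x + y) z = inner_upto n x z + inner_upto n y z"
  by (simp add: inner_upto_def distrib_right sum.distrib)

lemma inner_upto_diff_left: "inner_upto n (x - y) z = inner_upto n x z - inner_upto n y z"
  by (simp add: inner_upto_def left_diff_distrib sum_subtractf)

lemma inner_upto_scaleR_left: "inner_upto n (c *\<^sub>R x) z = c * inner_upto n x z"
  by (simp add: inner_upto_def sum_distrib_left mult.assoc)

lemma inner_upto_sum_left: "inner_upto n (\<Sum>i\<in>I. f i) z = (\<Sum>i\<in>I. inner_upto n (f i) z)"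
  by (simp add: inner_upto_def sum_apply sum_distrib_right) (rule sum.swap)

lemma inner_upto_add_right: "inner_upto n z (x + y) = inner_upto n z x + inner_upto n z y"
  by (simp add: inner_upto_commute[of n z] inner_upto_add_left)

lemma inner_upto_diff_right: "inner_upto n z (x - y) = inner_upto n z x - inner_upto n z y"
  by (simp add: inner_upto_commute[of n z] inner_upto_diff_left)

lemma inner_upto_scaleR_right: "inner_upto n z (c *\<^sub>R x) = c * inner_upto n z x"
  by (simp add: inner_upto_commute[of n z] inner_upto_scaleR_left)

lemma inner_upto_sum_right: "inner_upto n z (\<Sum>i\<in>I. f i) = (\<Sum>i\<in>I. inner_upto n z (f i))"
  by (simp add: inner_upto_commute[of n z] inner_upto_sum_left)

lemma inner_upto_zero [simp]: "inner_upto n 0 z = 0" "inner_upto n z 0 = 0"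
  by (simp_all add: inner_upto_def)

lemmas inner_upto_simps =
  inner_upto_add_left inner_upto_diff_left inner_upto_scaleR_left inner_upto_sum_left
  inner_upto_add_right inner_upto_diff_right inner_upto_scaleR_right inner_upto_sum_right

lemma inner_upto_self_nonneg [simp]: "0 \<le> inner_upto n x x"
  by (simp add: inner_upto_def sum_nonneg)

lemma inner_upto_self_eq_0:
  assumes "x \<in> topspace (Euclidean_space (Suc n))" "inner_upto n x x = 0"
  shows "x = 0"
proof
  fix i show "x i = 0 i"
    using assms by (cases "i \<le> n") (auto simp: inner_upto_def sum_nonneg_eq_0_iff mem_Euclidean_space)
qed

lemma dist_upto_eq_sqrt_inner: "dist_upto n x y = sqrt (inner_upto n (x - y) (x - y))"
  by (simp add: dist_upto_def L2_set_def inner_upto_def power2_eq_square)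

lemma dist_upto_power2: "(dist_upto n x y)\<^sup>2 = (\<Sum>i\<le>n. (x i - y i)\<^sup>2)"
  by (simp add: dist_upto_def L2_set_def sum_nonneg)

lemma dist_upto_nonneg [simp]: "0 \<le> dist_upto n x y"
  by (simp add: dist_upto_def)

lemma dist_upto_commute: "dist_upto n x y = dist_upto n y x"
  by (simp add: dist_upto_def L2_set_def power2_commute)

lemma dist_upto_triangle: "dist_upto n x z \<le> dist_upto n x y + dist_upto n y z"
  using L2_set_triangle_ineq[of "\<lambda>i. x i - y i" "\<lambda>i. y i - z i" "{..n}"] by (simp add: dist_upto_def)

section \<open>Orthonormal families and bases\<close>

definition orthonormal :: "nat \<Rightarrow> nat \<Rightarrow> (nat \<Rightarrow> nat \<Rightarrow> real) \<Rightarrow> bool" where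
  "orthonormal n k b \<longleftrightarrow>
     (\<forall>i<k. b i \<in> topspace (Euclidean_space (Suc n))) \<and>
     (\<forall>i<k. \<forall>j<k. inner_upto n (b i) (b j) = (if i = j then 1 else 0))"

lemma orthonormal_inner_combination:
  assumes "orthonormal n k b" "j < k"
  shows "inner_upto n (\<Sum>i<k. c i *\<^sub>R b i) (b j) = c j"
proof -
  have "inner_upto n (\<Sum>i<k. c i *\<^sub>R b i) (b j) = (\<Sum>i<k. c i * inner_upto n (b i) (b j))"
    by (simp add: inner_upto_sum_left inner_upto_scaleR_left)
  also have "\<dots> = (\<Sum>i<k. if i = j then c i else 0)"
    using assms by (intro sum.cong) (auto simp: orthonormal_def)
  finally have "inner_upto n (\<Sum>i<k. c i *\<^sub>R b i) (b j) = (\<Sum>i<k. if i = j then c i else 0)" .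
  then show ?thesis using assms by simp
qed

lemma orthonormal_inner_combinations:
  assumes "orthonormal n k b"
  shows "inner_upto n (\<Sum>i<k. c i *\<^sub>R b i) (\<Sum>i<k. d i *\<^sub>R b i) = (\<Sum>i<k. c i * d i)"
  using orthonormal_inner_combination[OF assms, of _ c]
  by (simp add: inner_upto_sum_right inner_upto_scaleR_right mult.commute)

lemma orthonormal_independent:
  assumes "orthonormal n k b"
  shows "inj_on b {..<k}" "independent (b ` {..<k})"
proof -
  show inj: "inj_on b {..<k}"
  proof (rule inj_onI)
    fix i j assume ij: "i \<in> {..<k}" "j \<in> {..<k}" "b i = b j"
    then have "inner_upto n (b i) (b j) = 1"
      using assms by (metis lessThan_iff orthonormal_def)
    then show "i = j"
      using assms ij by (metis lessThan_iff orthonormal_def zero_neq_one)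
  qed
  show "independent (b ` {..<k})"
  proof
    assume "dependent (b ` {..<k})"
    then obtain u j where j: "j < k" "u (b j) \<noteq> 0" and u: "(\<Sum>v\<in>b ` {..<k}. u v *\<^sub>R v) = 0"
      by (auto simp: dependent_finite)
    have "(\<Sum>i<k. u (b i) *\<^sub>R b i) = 0"
      using u by (simp add: sum.reindex[OF inj])
    then show False
      using orthonormal_inner_combination[OF assms j(1), of "\<lambda>i. u (b i)"] j(2) by simp
  qed
qed

lemma span_orthonormal_in_grassmannian:
  assumes "orthonormal n k b"
  shows "span (b ` {..<k}) \<in> grassmannian n k"
proof -
  have "span (b ` {..<k}) \<subseteq> topspace (Euclidean_space (Suc n))"
    using assms by (intro span_minimal subspace_Euclidean_space) (auto simp: orthonormal_def)
  moreover have "dim (span (b ` {..<k})) = k"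
    using orthonormal_independent[OF assms] by (simp add: dim_eq_card_independent card_image)
  ultimately show ?thesis by (simp add: grassmannian_def)
qed

text \<open>Gram-Schmidt. The step \<open>extend\<close> is used twice: fewer than \<open>k\<close>
  vectors cannot span \<open>V\<close>, so the family grows to length \<open>k\<close>; and a vector
  of \<open>V\<close> different from its expansion would lead to \<open>k + 1\<close> independent
  vectors in \<open>V\<close>.\<close>

lemma ex_orthonormal_basis:
  assumes V: "V \<in> grassmannian n k" and k: "0 < k"
  obtains b where "orthonormal n k b" "\<And>i. i < k \<Longrightarrow> b i \<in> V"
    "\<And>x. x \<in> V \<Longrightarrow> x = (\<Sum>i<k. inner_upto n x (b i) *\<^sub>R b i)"
proof -
  have sV: "subspace V" and VE: "V \<subseteq> topspace (Euclidean_space (Suc n))" and dV: "dim V = k"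
    using V by (auto simp: grassmannian_def)
  have comb: "(\<Sum>i<j. c i *\<^sub>R b i) \<in> V" if "\<And>i. i < j \<Longrightarrow> b i \<in> V" for b c and j :: nat
    using that sV by (intro subspace_sum subspace_scale) auto
  have extend: "\<exists>b. orthonormal n (Suc j) b \<and> (\<forall>i<Suc j. b i \<in> V)"
    if b: "orthonormal n j b" "\<forall>i<j. b i \<in> V"
      and x: "x \<in> V" "x \<noteq> (\<Sum>i<j. inner_upto n x (b i) *\<^sub>R b i)" for j b x
  proof -
    define y where "y = x - (\<Sum>i<j. inner_upto n x (b i) *\<^sub>R b i)"
    have yV: "y \<in> V" unfolding y_def using x(1) comb b(2) sV by (auto intro: subspace_diff)
    have yb: "inner_upto n y (b i) = 0" if "i < j" for i
      unfolding y_def inner_upto_diff_left orthonormal_inner_combination[OF b(1) that] by simp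
    have "inner_upto n y y \<noteq> 0"
      using inner_upto_self_eq_0[of y n] yV VE x(2) by (auto simp: y_def)
    then have pos: "0 < inner_upto n y y" using inner_upto_self_nonneg[of n y] by linarith
    define u where "u = (1 / sqrt (inner_upto n y y)) *\<^sub>R y"
    have uV: "u \<in> V" unfolding u_def using yV sV by (rule subspace_scale[rotated])
    have "inner_upto n u u = inner_upto n y y / (sqrt (inner_upto n y y))\<^sup>2"
      by (simp add: u_def inner_upto_simps power2_eq_square)
    then have uu: "inner_upto n u u = 1" using pos by simp
    have ub: "inner_upto n u (b i) = 0" if "i < j" for i
      using yb[OF that] by (simp add: u_def inner_upto_simps)
    have mem: "(b(j := u)) i \<in> V" if "i < Suc j" for i
      using b(2) uV that by (cases "i = j") auto
    moreover have "orthonormal n (Suc j) (b(j := u))"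
      unfolding orthonormal_def
    proof (intro conjI allI impI)
      fix i l assume il: "i < Suc j" "l < Suc j"
      consider "i = j" "l = j" | "i = j" "l < j" | "i < j" "l = j" | "i < j" "l < j"
        using il by linarith
      then show "inner_upto n ((b(j := u)) i) ((b(j := u)) l) = (if i = l then 1 else 0)"
      proof cases
        case 3
        then show ?thesis using ub[of i] inner_upto_commute[of n u "b i"] by simp
      next
        case 4
        then show ?thesis using b(1) by (simp add: orthonormal_def)
      qed (simp_all add: uu ub)
    qed (use mem VE in blast)
    ultimately show ?thesis by blast
  qed
  have "\<exists>b. orthonormal n j b \<and> (\<forall>i<j. b i \<in> V)" if "j \<le> k" for j
    using that
  proof (induction j)
    case 0
    then show ?case by (simp add: orthonormal_def)
  next
    case (Suc j)
    then obtain b where b: "orthonormal n j b" "\<forall>i<j. b i \<in> V" by auto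
    have "\<not> V \<subseteq> span (b ` {..<j})"
    proof
      assume "V \<subseteq> span (b ` {..<j})"
      then have "dim V \<le> card (b ` {..<j})" by (intro dim_le_card) auto
      also have "\<dots> \<le> j" using card_image_le[of "{..<j}" b] by simp
      finally show False using dV Suc.prems by simp
    qed
    then obtain x where x: "x \<in> V" "x \<notin> span (b ` {..<j})" by blast
    have "(\<Sum>i<j. inner_upto n x (b i) *\<^sub>R b i) \<in> span (b ` {..<j})"
      by (intro span_sum span_scale span_base) auto
    then have "x \<noteq> (\<Sum>i<j. inner_upto n x (b i) *\<^sub>R b i)" using x(2) by metis
    then show ?case using extend b x(1) by blast
  qed
  then obtain b where b: "orthonormal n k b" "\<forall>i<k. b i \<in> V" by blast
  have "x = (\<Sum>i<k. inner_upto n x (b i) *\<^sub>R b i)" if x: "x \<in> V" for x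
  proof (rule ccontr)
    assume "x \<noteq> (\<Sum>i<k. inner_upto n x (b i) *\<^sub>R b i)"
    then obtain c where c: "orthonormal n (Suc k) c" "\<forall>i<Suc k. c i \<in> V"
      using extend b x by blast
    obtain B where B: "B \<subseteq> V" "V \<subseteq> span B" "card B = k"
      using basis_exists[of V] dV by metis
    \<comment> \<open>\<open>card\<close> of an infinite set is 0, so \<open>0 < k\<close> makes the
      basis finite.\<close>
    have "finite B" using B(3) k card.infinite by fastforce
    then have "card (c ` {..<Suc k}) \<le> card B"
      using orthonormal_independent[OF c(1)] c(2) B
      by (intro conjunct2[OF independent_span_bound]) auto
    then show False
      using card_image[OF orthonormal_independent(1)[OF c(1)]] B(3) by simp
  qed
  with b that show thesis by blast
qed

lemma span_orthonormal_basis: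
  assumes "V \<in> grassmannian n k" "\<And>i. i < k \<Longrightarrow> b i \<in> V"
    "\<And>x. x \<in> V \<Longrightarrow> x = (\<Sum>i<k. inner_upto n x (b i) *\<^sub>R b i)"
  shows "V = span (b ` {..<k})"
proof
  show "V \<subseteq> span (b ` {..<k})"
  proof
    fix x assume "x \<in> V"
    have "(\<Sum>i<k. inner_upto n x (b i) *\<^sub>R b i) \<in> span (b ` {..<k})"
      by (intro span_sum span_scale span_base) auto
    then show "x \<in> span (b ` {..<k})" using assms(3)[OF \<open>x \<in> V\<close>] by metis
  qed
  show "span (b ` {..<k}) \<subseteq> V"
    using assms(1,2) by (intro span_minimal) (auto simp: grassmannian_def)
qed

text \<open>\<open>orth_proj\<close> is a definite description, so uniqueness is the point: two
  candidates differ by a vector of \<open>V\<close> that is orthogonal to \<open>V\<close>, hence to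
  itself.\<close>

lemma orth_proj_eqI:
  assumes V: "V \<in> grassmannian n k" and y: "y \<in> V" "\<And>v. v \<in> V \<Longrightarrow> inner_upto n (x - y) v = 0"
  shows "orth_proj n V x = y"
  unfolding orth_proj_def
proof (rule the_equality)
  fix y' assume y': "y' \<in> V \<and> (\<forall>v\<in>V. inner_upto n (x - y') v = 0)"
  have sV: "subspace V" and VE: "V \<subseteq> topspace (Euclidean_space (Suc n))"
    using V by (auto simp: grassmannian_def)
  have d: "y' - y \<in> V" using y y' sV by (auto intro: subspace_diff)
  have "inner_upto n (y' - y) (y' - y) = inner_upto n (x - y) (y' - y) - inner_upto n (x - y') (y' - y)"
    by (simp flip: inner_upto_diff_left)
  also have "\<dots> = 0" using y(2) y' d by simp
  finally have "y' - y = 0" using d VE by (intro inner_upto_self_eq_0) auto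
  then show "y' = y" by simp
qed (use y in auto)

lemma orth_proj_orthonormal:
  assumes V: "V \<in> grassmannian n k" and b: "orthonormal n k b" "\<And>i. i < k \<Longrightarrow> b i \<in> V"
    "\<And>x. x \<in> V \<Longrightarrow> x = (\<Sum>i<k. inner_upto n x (b i) *\<^sub>R b i)"
  shows "orth_proj n V x = (\<Sum>i<k. inner_upto n x (b i) *\<^sub>R b i)"
proof (rule orth_proj_eqI[OF V])
  show "(\<Sum>i<k. inner_upto n x (b i) *\<^sub>R b i) \<in> V"
    using V b(2) by (intro subspace_sum subspace_scale) (auto simp: grassmannian_def)
  fix v assume "v \<in> V"
  have z: "inner_upto n (x - (\<Sum>i<k. inner_upto n x (b i) *\<^sub>R b i)) (b j) = 0" if "j < k" for j
    unfolding inner_upto_diff_left orthonormal_inner_combination[OF b(1) that] by simp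
  show "inner_upto n (x - (\<Sum>i<k. inner_upto n x (b i) *\<^sub>R b i)) v = 0"
    by (subst b(3)[OF \<open>v \<in> V\<close>]) (simp add: inner_upto_sum_right inner_upto_scaleR_right z)
qed

lemma
  assumes "V \<in> grassmannian n k" "0 < k"
  shows orth_proj_mem: "orth_proj n V x \<in> V"
    and orth_proj_orthogonal: "v \<in> V \<Longrightarrow> inner_upto n (x - orth_proj n V x) v = 0"
proof -
  obtain b where b: "orthonormal n k b" "\<And>i. i < k \<Longrightarrow> b i \<in> V"
    "\<And>x. x \<in> V \<Longrightarrow> x = (\<Sum>i<k. inner_upto n x (b i) *\<^sub>R b i)"
    using ex_orthonormal_basis[OF assms] by metis
  have eq: "orth_proj n V x = (\<Sum>i<k. inner_upto n x (b i) *\<^sub>R b i)"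
    using orth_proj_orthonormal[OF assms(1) b] .
  show "orth_proj n V x \<in> V"
    unfolding eq using assms(1) b(2) by (intro subspace_sum subspace_scale) (auto simp: grassmannian_def)
  assume "v \<in> V"
  have z: "inner_upto n (x - orth_proj n V x) (b j) = 0" if "j < k" for j
    unfolding eq inner_upto_diff_left orthonormal_inner_combination[OF b(1) that] by simp
  show "inner_upto n (x - orth_proj n V x) v = 0"
    by (subst b(3)[OF \<open>v \<in> V\<close>]) (simp add: inner_upto_sum_right inner_upto_scaleR_right z)
qed

lemma orth_proj_of_mem: "V \<in> grassmannian n k \<Longrightarrow> x \<in> V \<Longrightarrow> orth_proj n V x = x"
  by (rule orth_proj_eqI) auto

lemma dist_upto_orth_proj_le:
  assumes V: "V \<in> grassmannian n k" "0 < k" and v: "v \<in> V"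
  shows "dist_upto n x (orth_proj n V x) \<le> dist_upto n x v"
proof -
  let ?p = "orth_proj n V x"
  have d: "?p - v \<in> V" using orth_proj_mem[OF V] v V(1) by (auto simp: grassmannian_def intro: subspace_diff)
  \<comment> \<open>Pythagoras: the cross term vanishes because \<open>?p - v\<close> lies in
    \<open>V\<close>.\<close>
  have "x - v = (x - ?p) + (?p - v)" by simp
  then have "inner_upto n (x - v) (x - v) =
      inner_upto n (x - ?p) (x - ?p) + 2 * inner_upto n (x - ?p) (?p - v) + inner_upto n (?p - v) (?p - v)"
    by (simp only: inner_upto_add_left inner_upto_add_right inner_upto_commute[of n "?p - v" "x - ?p"])
  then have "inner_upto n (x - ?p) (x - ?p) \<le> inner_upto n (x - v) (x - v)"
    using orth_proj_orthogonal[OF V d] by simp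
  then show ?thesis by (simp add: dist_upto_eq_sqrt_inner)
qed

section \<open>Reflections in hyperplanes\<close>

definition reflection :: "nat \<Rightarrow> (nat \<Rightarrow> real) \<Rightarrow> (nat \<Rightarrow> real) \<Rightarrow> nat \<Rightarrow> real" where
  "reflection n w x = x - (2 * inner_upto n x w) *\<^sub>R w"

lemma linear_reflection: "linear (reflection n w)"
  by (rule linearI) (auto simp: reflection_def inner_upto_simps algebra_simps)

lemma
  assumes "inner_upto n w w = 1"
  shows inner_reflection: "inner_upto n (reflection n w x) (reflection n w y) = inner_upto n x y"
    and reflection_reflection: "reflection n w (reflection n w x) = x"
proof -
  have w: "inner_upto n (reflection n w z) w = - inner_upto n z w" for z
    unfolding reflection_def inner_upto_diff_left inner_upto_scaleR_left using assms by simp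
  show "inner_upto n (reflection n w x) (reflection n w y) = inner_upto n x y"
    unfolding reflection_def[of n w y] inner_upto_diff_right inner_upto_scaleR_right w
    unfolding reflection_def inner_upto_diff_left inner_upto_scaleR_left
    by (simp add: inner_upto_commute[of n w y])
  show "reflection n w (reflection n w x) = x"
    by (subst reflection_def, unfold w) (simp add: reflection_def)
qed

lemma reflection_Euclidean_space:
  "w \<in> topspace (Euclidean_space (Suc n)) \<Longrightarrow> x \<in> topspace (Euclidean_space (Suc n)) \<Longrightarrow>
   reflection n w x \<in> topspace (Euclidean_space (Suc n))"
  by (simp add: mem_Euclidean_space reflection_def)

lemma orthogonal_upto_reflection:
  "w \<in> topspace (nsphere n) \<Longrightarrow> orthogonal_upto n (reflection n w)"
  by (simp add: orthogonal_upto_def linear_reflection reflection_Euclidean_space inner_reflection mem_nsphere)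

text \<open>Reflect in the hyperplane orthogonal to \<open>x - y\<close>. For unit vectors,
  \<open>2 * inner_upto n x (x - y)\<close> is the squared length of \<open>x - y\<close>, so the
  reflection subtracts exactly \<open>x - y\<close>. Thus reflections act transitively on the
  sphere.\<close>

lemma ex_reflection_swapping:
  assumes "x \<in> topspace (nsphere n)" "y \<in> topspace (nsphere n)" "x \<noteq> y"
  obtains w where "w \<in> topspace (nsphere n)" "reflection n w x = y"
proof -
  let ?s = "inner_upto n (x - y) (x - y)"
  have E: "x - y \<in> topspace (Euclidean_space (Suc n))"
    using assms by (auto simp: mem_nsphere intro: subspace_diff[OF subspace_Euclidean_space])
  have "?s \<noteq> 0" using inner_upto_self_eq_0[OF E] assms(3) by auto
  then have pos: "?s > 0" using inner_upto_self_nonneg[of n "x - y"] by linarith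
  define w where "w = (1 / sqrt ?s) *\<^sub>R (x - y)"
  have "inner_upto n w w = ?s / (sqrt ?s)\<^sup>2"
    unfolding w_def inner_upto_scaleR_left inner_upto_scaleR_right by (simp add: power2_eq_square)
  then have "w \<in> topspace (nsphere n)"
    using pos E subspace_scale[OF subspace_Euclidean_space E] by (simp add: mem_nsphere w_def)
  moreover have "2 * inner_upto n x (x - y) = ?s"
    using assms by (simp add: mem_nsphere inner_upto_simps inner_upto_commute[of n y x])
  then have "(2 * inner_upto n x w) *\<^sub>R w = (?s / (sqrt ?s)\<^sup>2) *\<^sub>R (x - y)"
    unfolding w_def inner_upto_scaleR_right by (simp add: power2_eq_square)
  then have "reflection n w x = y"
    using pos by (simp add: reflection_def)
  ultimately show thesis by (rule that)
qed

text \<open>Orthonormal bases go to orthonormal bases. Being an isometric involution, the reflection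
  conjugates the projection onto \<open>V\<close> into the projection onto the image; this formula
  later makes its action on the Grassmannian continuous.\<close>

lemma reflection_grassmannian:
  assumes w: "w \<in> topspace (nsphere n)" and V: "V \<in> grassmannian n k" "0 < k"
  shows "reflection n w ` V \<in> grassmannian n k"
    and "orth_proj n (reflection n w ` V) x = reflection n w (orth_proj n V (reflection n w x))"
proof -
  let ?R = "reflection n w"
  have ww: "inner_upto n w w = 1" using w by (simp add: mem_nsphere)
  obtain b where b: "orthonormal n k b" "\<And>i. i < k \<Longrightarrow> b i \<in> V"
    "\<And>x. x \<in> V \<Longrightarrow> x = (\<Sum>i<k. inner_upto n x (b i) *\<^sub>R b i)"
    using ex_orthonormal_basis[OF V] by metis
  have "orthonormal n k (?R \<circ> b)"
    using b(1) w by (auto simp: orthonormal_def inner_reflection[OF ww] mem_nsphere intro: reflection_Euclidean_space)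
  moreover have "?R ` V = span ((?R \<circ> b) ` {..<k})"
    using span_orthonormal_basis[OF V(1) b(2,3)] linear_span_image[OF linear_reflection, of n w "b ` {..<k}"]
    by (simp add: image_comp)
  ultimately show RV: "?R ` V \<in> grassmannian n k"
    using span_orthonormal_in_grassmannian by metis
  show "orth_proj n (?R ` V) x = ?R (orth_proj n V (?R x))"
  proof (rule orth_proj_eqI[OF RV])
    show "?R (orth_proj n V (?R x)) \<in> ?R ` V" using orth_proj_mem[OF V] by simp
    fix v assume "v \<in> ?R ` V"
    then obtain u where u: "u \<in> V" "v = ?R u" by blast
    have "inner_upto n (x - ?R (orth_proj n V (?R x))) v
        = inner_upto n (?R (?R x - orth_proj n V (?R x))) (?R u)"
      by (simp only: linear_diff[OF linear_reflection] reflection_reflection[OF ww] u(2))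
    also have "\<dots> = 0"
      using orth_proj_orthogonal[OF V u(1)] by (simp only: inner_reflection[OF ww])
    finally show "inner_upto n (x - ?R (orth_proj n V (?R x))) v = 0" .
  qed
qed

section \<open>Packings and nets on the sphere\<close>

text \<open>This counts lattice points in a ball of radius \<open>7 * sqrt (card I)\<close>: by
  Cauchy-Schwarz the differences \<open>z - x\<close> have l1 norm at most
  \<open>7 * card I\<close>, which the generating function bound can handle.\<close>

lemma card_grid_ball_le:
  assumes X: "X \<subseteq> extensional I" "finite I"
  shows "card {x \<in> X. (\<Sum>i\<in>I. (z i - x i)\<^sup>2) < 49 * int (card I)} \<le> 640 ^ card I"
proof -
  let ?X = "{x \<in> X. (\<Sum>i\<in>I. (z i - x i)\<^sup>2) < 49 * int (card I)}"
  define d where "d = (\<lambda>x. restrict (\<lambda>i. z i - x i) I)"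
  have inj: "inj_on d ?X"
  proof (rule inj_onI)
    fix x y assume xy: "x \<in> ?X" "y \<in> ?X" "d x = d y"
    have "x i = y i" if "i \<in> I" for i
      using fun_cong[OF xy(3), of i] that by (simp add: d_def)
    then show "x = y" using xy(1,2) X(1) by (intro extensionalityI[of x I y]) auto
  qed
  have T: "(\<Sum>i\<in>I. \<bar>a i\<bar>) \<le> int (7 * card I)" if a: "a \<in> d ` ?X" for a
  proof -
    obtain x where x: "x \<in> ?X" "a = d x" using a by blast
    have "(\<Sum>i\<in>I. (real_of_int (a i))\<^sup>2) = real_of_int (\<Sum>i\<in>I. (z i - x i)\<^sup>2)"
      by (simp add: x(2) d_def)
    also have "\<dots> \<le> real_of_int (49 * int (card I))"
      using x(1) by (intro of_int_le_iff[THEN iffD2]) simp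
    also have "\<dots> = 49 * real (card I)" by simp
    finally have sq: "(\<Sum>i\<in>I. (real_of_int (a i))\<^sup>2) \<le> 49 * real (card I)" .
    have "(\<Sum>i\<in>I. \<bar>real_of_int (a i)\<bar>)\<^sup>2 \<le> (\<Sum>i\<in>I. \<bar>real_of_int (a i)\<bar>\<^sup>2) * card I"
      by (rule sum_squared_le_sum_of_squares)
    also have "\<dots> \<le> (49 * real (card I)) * real (card I)" using sq by (intro mult_right_mono) auto
    also have "\<dots> = (7 * real (card I))\<^sup>2" by (simp add: power2_eq_square)
    finally have "(\<Sum>i\<in>I. \<bar>real_of_int (a i)\<bar>) \<le> 7 * real (card I)" by (rule power2_le_imp_le) auto
    then have "real_of_int (\<Sum>i\<in>I. \<bar>a i\<bar>) \<le> real_of_int (int (7 * card I))" by simp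
    then show ?thesis by (simp only: of_int_le_iff)
  qed
  \<comment> \<open>With \<open>t = 1 / 2\<close> and \<open>l = 1\<close>, each coordinate costs a
    factor \<open>5 * 2 ^ 7 = 640\<close>.\<close>
  have "real (card (d ` ?X)) * 1 ^ 0 * (1 / 2) ^ (7 * card I) \<le> (2 / (1 - 1 / 2) + 1) ^ card I"
    by (rule card_int_vectors_le(2)) (use X T in \<open>auto simp: d_def\<close>)
  then have "real (card ?X) * (1 / 2 ^ 7) ^ card I \<le> 5 ^ card I"
    by (simp add: card_image[OF inj] power_mult power_one_over)
  then have "real (card ?X) \<le> 5 ^ card I * 128 ^ card I"
    by (simp add: power_one_over field_simps)
  also have "\<dots> = real (640 ^ card I)" by (simp flip: power_mult_distrib)
  finally show ?thesis by (simp only: of_nat_le_iff)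
qed

text \<open>The grid \<open>{-m..m}^n\<close> has \<open>(2 * m + 1) ^ n\<close> points, at most
  \<open>640 ^ n\<close> of them in any ball of radius \<open>7 * sqrt n\<close>, so a maximal
  separated subset has at least \<open>(2 * m / 640) ^ n\<close> points. It is then scaled and
  lifted to the sphere.\<close>

lemma ex_separated_points:
  fixes m n :: nat
  assumes n: "0 < n" and m: "0 < m"
  obtains Z where "finite Z" "Z \<subseteq> topspace (nsphere n)"
    "\<And>x y. x \<in> Z \<Longrightarrow> y \<in> Z \<Longrightarrow> x \<noteq> y \<Longrightarrow> 7 / m \<le> dist_upto n x y"
    "(m / 320) ^ n \<le> real (card Z)"
proof -
  define X where "X = Pi\<^sub>E {..<n} (\<lambda>_. {- int m..int m})"
  define cl :: "(nat \<Rightarrow> int) \<Rightarrow> (nat \<Rightarrow> int) \<Rightarrow> bool"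
    where "cl = (\<lambda>a b. (\<Sum>i<n. (a i - b i)\<^sup>2) < 49 * int n)"
  have "finite X" by (auto simp: X_def intro!: finite_PiE)
  moreover have "card {x \<in> X. cl z x} \<le> 640 ^ n" for z
    using card_grid_ball_le[of X "{..<n}" z] by (auto simp: cl_def X_def PiE_def)
  ultimately obtain Y where Y: "Y \<subseteq> X"
    "\<And>x y. x \<in> Y \<Longrightarrow> y \<in> Y \<Longrightarrow> x \<noteq> y \<Longrightarrow> \<not> cl x y" "card X \<le> card Y * 640 ^ n"
    using n by (elim maximal_separated_subset[of X cl "640 ^ n"]) (auto simp: cl_def power2_commute)
  \<comment> \<open>The cube \<open>[-m, m]^n\<close> has circumradius \<open>m * sqrt n\<close>;
    this scaling puts it into the unit ball and turns the separation \<open>7 * sqrt n\<close> into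
    \<open>7 / m\<close>.\<close>
  define s where "s = 1 / (m * sqrt n)"
  have s2: "s\<^sup>2 = 1 / (m\<^sup>2 * n)" by (simp add: s_def power_divide power_mult_distrib)
  \<comment> \<open>grid points of the equatorial ball, lifted to the upper hemisphere\<close>
  define f :: "(nat \<Rightarrow> int) \<Rightarrow> nat \<Rightarrow> real"
    where "f = (\<lambda>a i. if i < n then s * a i else if i = n then sqrt (1 - (\<Sum>j<n. (s * a j)\<^sup>2)) else 0)"
  have split: "{..n} = insert n {..<n}" by auto
  have far: "7 / m \<le> dist_upto n (f a) (f b)" if ab: "a \<in> Y" "b \<in> Y" "a \<noteq> b" for a b
  proof -
    have "49 * int n \<le> (\<Sum>i<n. (a i - b i)\<^sup>2)" using Y(2)[OF ab] by (simp add: cl_def)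
    then have "real_of_int (49 * int n) \<le> real_of_int (\<Sum>i<n. (a i - b i)\<^sup>2)"
      by (simp only: of_int_le_iff)
    then have *: "49 * real n \<le> (\<Sum>i<n. (real_of_int (a i) - b i)\<^sup>2)" by simp
    have "(7 / m)\<^sup>2 = s\<^sup>2 * (49 * real n)"
      using n by (simp add: s2 power_divide)
    also have "\<dots> \<le> s\<^sup>2 * (\<Sum>i<n. (real_of_int (a i) - b i)\<^sup>2)"
      using * by (intro mult_left_mono) auto
    also have "\<dots> = (\<Sum>i<n. (f a i - f b i)\<^sup>2)"
      by (simp add: f_def sum_distrib_left flip: right_diff_distrib power_mult_distrib)
    \<comment> \<open>The lifted coordinate can only increase the distance.\<close>
    also have "\<dots> \<le> (dist_upto n (f a) (f b))\<^sup>2"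
      by (simp add: dist_upto_power2 split)
    finally show ?thesis by (rule power2_le_imp_le) simp
  qed
  have sph: "f a \<in> topspace (nsphere n)" if "a \<in> X" for a
  proof -
    have "(s * a j)\<^sup>2 \<le> 1 / n" if "j < n" for j
    proof -
      have "\<bar>a j\<bar> \<le> int m" using \<open>a \<in> X\<close> that by (force simp: X_def PiE_def Pi_def abs_le_iff)
      then have "\<bar>real_of_int (a j)\<bar> \<le> real m" by linarith
      then have "\<bar>real_of_int (a j)\<bar>\<^sup>2 \<le> (real m)\<^sup>2" by (intro power_mono) auto
      then show ?thesis using m n by (simp add: power_mult_distrib s2 field_simps)
    qed
    then have "(\<Sum>j<n. (s * a j)\<^sup>2) \<le> (\<Sum>j<n. 1 / n)" by (intro sum_mono) auto
    then have "(\<Sum>j<n. (s * a j)\<^sup>2) \<le> 1" using n by simp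
    moreover have "(\<Sum>i<n. f a i * f a i) = (\<Sum>j<n. (s * a j)\<^sup>2)"
      by (simp add: f_def power2_eq_square)
    ultimately show ?thesis
      by (simp add: mem_nsphere mem_Euclidean_space inner_upto_def split)
         (simp add: f_def)
  qed
  have inj: "inj_on f Y"
  proof (rule inj_onI)
    fix a b assume ab: "a \<in> Y" "b \<in> Y" "f a = f b"
    show "a = b"
    proof (rule ccontr)
      assume "a \<noteq> b"
      then have "7 / m \<le> dist_upto n (f a) (f b)" using far ab by blast
      moreover have "dist_upto n (f a) (f b) = 0" by (simp add: ab(3) dist_upto_def L2_set_def)
      ultimately show False using m by simp
    qed
  qed
  have "card X = (2 * m + 1) ^ n"
    by (simp add: X_def card_PiE nat_add_distrib nat_mult_distrib)
  then have "real ((2 * m) ^ n) \<le> real (card Y * 640 ^ n)"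
    using Y(3) power_mono[of "2 * m" "2 * m + 1" n] by (simp only: of_nat_le_iff) linarith
  moreover have "real ((2 * m) ^ n) = (m / 320 * 640) ^ n" by simp
  then have "real ((2 * m) ^ n) = (m / 320) ^ n * 640 ^ n" by (simp only: power_mult_distrib)
  ultimately have "(m / 320) ^ n * 640 ^ n \<le> real (card Y) * 640 ^ n" by simp
  then have "(m / 320) ^ n \<le> real (card Y)" by simp
  then have "(m / 320) ^ n \<le> real (card (f ` Y))" by (simp add: card_image[OF inj])
  moreover have "finite (f ` Y)" using \<open>finite X\<close> Y(1) finite_subset by blast
  ultimately show thesis
    using sph far Y(1) by (intro that[of "f ` Y"]) blast+
qed

text \<open>A point of \<open>Z\<close> near \<open>V\<close> is determined by the rounded
  coordinates of its projection in an orthonormal basis of \<open>V\<close>. These are integer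
  vectors of length \<open>k\<close> and l1 norm at most \<open>k * m\<close>, so their number is
  exponential in \<open>k\<close> instead of \<open>n\<close>.\<close>

lemma card_separated_near_subspace_le:
  fixes m :: nat
  assumes V: "V \<in> grassmannian n k" "0 < k" and m: "0 < m"
    and Z: "finite Z" "Z \<subseteq> topspace (nsphere n)"
    "\<And>x y. x \<in> Z \<Longrightarrow> y \<in> Z \<Longrightarrow> x \<noteq> y \<Longrightarrow> 7 / m \<le> dist_upto n x y"
  shows "card {z \<in> Z. dist_upto n z (orth_proj n V z) \<le> 2 / m} \<le> (5 * 2 ^ m) ^ k"
proof -
  let ?Y = "{z \<in> Z. dist_upto n z (orth_proj n V z) \<le> 2 / m}"
  obtain b where b: "orthonormal n k b" "\<And>i. i < k \<Longrightarrow> b i \<in> V"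
    "\<And>x. x \<in> V \<Longrightarrow> x = (\<Sum>i<k. inner_upto n x (b i) *\<^sub>R b i)"
    using ex_orthonormal_basis[OF V] by metis
  note proj = orth_proj_orthonormal[OF V(1) b]
  define c where "c = (\<lambda>z i. inner_upto n z (b i))"
  define a where "a = (\<lambda>z. restrict (\<lambda>i. trunc (c z i * (m * sqrt (card {..<k})))) {..<k})"
  \<comment> \<open>Bessel's inequality gives radius 1 for the coefficients, as needed in
    \<open>sum_abs_trunc_le\<close>.\<close>
  have bessel: "(\<Sum>i<k. (c z i)\<^sup>2) \<le> 1" if z: "z \<in> topspace (nsphere n)" for z
  proof -
    let ?p = "orth_proj n V z"
    have "inner_upto n (z - ?p) ?p = 0" using orth_proj_orthogonal[OF V] orth_proj_mem[OF V] by simp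
    then have "inner_upto n ?p ?p = inner_upto n z ?p" by (simp add: inner_upto_diff_left)
    moreover have "0 \<le> inner_upto n (z - ?p) (z - ?p)" by simp
    then have "2 * inner_upto n z ?p \<le> 1 + inner_upto n ?p ?p"
      using z by (simp add: inner_upto_simps mem_nsphere inner_upto_commute[of n ?p z])
    moreover have "inner_upto n ?p ?p = (\<Sum>i<k. (c z i)\<^sup>2)"
      by (simp add: proj orthonormal_inner_combinations[OF b(1)] c_def power2_eq_square)
    ultimately show ?thesis by simp
  qed
  have inj: "inj_on a ?Y"
  proof (rule inj_onI)
    fix x y assume xy: "x \<in> ?Y" "y \<in> ?Y" "a x = a y"
    have "trunc (c x i * (m * sqrt (card {..<k}))) = trunc (c y i * (m * sqrt (card {..<k})))"
      if "i \<in> {..<k}" for i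
      using fun_cong[OF xy(3), of i] that by (simp add: a_def)
    then have "(\<Sum>i<k. (c x i - c y i)\<^sup>2) \<le> (2 / m)\<^sup>2"
      using V(2) m by (intro trunc_scaled_eqD) auto
    moreover have "orth_proj n V x - orth_proj n V y = (\<Sum>i<k. (c x i - c y i) *\<^sub>R b i)"
      by (simp add: proj c_def scaleR_left_diff_distrib sum_subtractf)
    then have "(dist_upto n (orth_proj n V x) (orth_proj n V y))\<^sup>2 = (\<Sum>i<k. (c x i - c y i)\<^sup>2)"
      by (simp add: dist_upto_eq_sqrt_inner orthonormal_inner_combinations[OF b(1)] power2_eq_square
          sum_nonneg flip: real_sqrt_mult)
    ultimately have "(dist_upto n (orth_proj n V x) (orth_proj n V y))\<^sup>2 \<le> (2 / m)\<^sup>2" by simp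
    then have "dist_upto n (orth_proj n V x) (orth_proj n V y) \<le> 2 / m"
      by (rule power2_le_imp_le) simp
    moreover have "dist_upto n x y \<le> dist_upto n x (orth_proj n V x)
        + (dist_upto n (orth_proj n V x) (orth_proj n V y) + dist_upto n y (orth_proj n V y))"
      using dist_upto_triangle[of n x y "orth_proj n V x"]
        dist_upto_triangle[of n "orth_proj n V x" y "orth_proj n V y"]
      by (simp add: dist_upto_commute[of n "orth_proj n V y" y])
    \<comment> \<open>Three moves of length at most \<open>2 / m\<close>: from \<open>x\<close> to
      its projection, to that of \<open>y\<close>, and on to \<open>y\<close>. The separation
      \<open>7 / m\<close> is chosen to exceed their sum.\<close>
    ultimately have "dist_upto n x y \<le> 6 / m" using xy(1,2) by simp
    moreover have "6 / m < 7 / real m" using m by (simp add: divide_strict_right_mono)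
    ultimately show "x = y" using Z(3)[of x y] xy(1,2) by force
  qed
  have T: "(\<Sum>i<k. \<bar>v i\<bar>) \<le> int (k * m)" if v: "v \<in> a ` ?Y" for v
  proof -
    obtain z where z: "z \<in> ?Y" "v = a z" using v by blast
    have "(\<Sum>i<k. \<bar>trunc (c z i * (m * sqrt (card {..<k})))\<bar>) \<le> int (card {..<k} * 1 * m)"
      using bessel[of z] z(1) Z(2) by (intro sum_abs_trunc_le) auto
    then show ?thesis by (simp add: z(2) a_def)
  qed
  have "real (card (a ` ?Y)) * 1 ^ 0 * (1 / 2) ^ (k * m) \<le> (2 / (1 - 1 / 2) + 1) ^ card {..<k}"
    by (rule card_int_vectors_le(2)) (use T in \<open>auto simp: a_def\<close>)
  then have "real (card ?Y) * (1 / 2 ^ m) ^ k \<le> 5 ^ k"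
    by (simp add: card_image[OF inj] power_mult[symmetric] power_one_over mult.commute[of k m])
  then have "real (card ?Y) \<le> 5 ^ k * (2 ^ m) ^ k"
    by (simp add: power_one_over field_simps)
  also have "\<dots> = real ((5 * 2 ^ m) ^ k)" by (simp add: power_mult_distrib)
  finally show ?thesis by (simp only: of_nat_le_iff)
qed

text \<open>The condition \<open>\<bar>x i * s\<bar> < 1\<close> singles out the coordinates that
  \<open>spread_map n s\<close> does not cut off; at scale \<open>s\<close> these are also the ones
  that \<open>trunc\<close> sends to 0.\<close>

definition sparse_points :: "nat \<Rightarrow> real \<Rightarrow> nat \<Rightarrow> (nat \<Rightarrow> real) set" where
  "sparse_points n s q = {x \<in> topspace (nsphere n). q \<le> card {i \<in> {..n}. \<bar>x i * s\<bar> < 1}}"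

text \<open>Points are classified by their rounding at scale \<open>m * sqrt (Suc n)\<close>. At
  least \<open>q\<close> of its entries vanish, and the weight \<open>l = m\<close> on zeros turns
  this into a gain of \<open>m ^ q\<close>.\<close>

lemma ex_net_sparse_points:
  fixes j n q :: nat
  defines "m \<equiv> 2 * j"
  assumes j: "0 < j"
  obtains R where "finite R" "R \<subseteq> topspace (nsphere n)"
    "\<And>x. x \<in> sparse_points n (m * sqrt (Suc n)) q \<Longrightarrow> \<exists>r\<in>R. dist_upto n x r \<le> 2 / m"
    "real (card R) * real m ^ q \<le> (12 * real m) ^ Suc n"
proof -
  let ?s = "m * sqrt (Suc n)"
  let ?S = "sparse_points n ?s q"
  have m2: "real m \<ge> 2" "m > 0" using j by (auto simp: m_def)
  define a where "a = (\<lambda>x. restrict (\<lambda>i. trunc (x i * (m * sqrt (card {..n})))) {..n})"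
  have T: "(\<Sum>i\<in>{..n}. \<bar>v i\<bar>) \<le> int (Suc n * m)" if v: "v \<in> a ` ?S" for v
  proof -
    obtain x where x: "x \<in> ?S" "v = a x" using v by blast
    have "(\<Sum>i\<le>n. (x i)\<^sup>2) = 1"
      using x(1) by (simp add: sparse_points_def mem_nsphere inner_upto_def power2_eq_square)
    then have "(\<Sum>i\<in>{..n}. \<bar>trunc (x i * (m * sqrt (card {..n})))\<bar>) \<le> int (card {..n} * 1 * m)"
      by (intro sum_abs_trunc_le) simp
    then show ?thesis by (simp add: x(2) a_def)
  qed
  have q: "q \<le> card {i \<in> {..n}. v i = 0}" if v: "v \<in> a ` ?S" for v
  proof -
    obtain x where x: "x \<in> ?S" "v = a x" using v by blast
    have "q \<le> card {i \<in> {..n}. \<bar>x i * ?s\<bar> < 1}" using x(1) by (simp add: sparse_points_def)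
    also have "\<dots> \<le> card {i \<in> {..n}. v i = 0}"
      by (intro card_mono) (auto simp: x(2) a_def trunc_eq_0)
    finally show ?thesis .
  qed
  have ext: "a ` ?S \<subseteq> extensional {..n}" by (auto simp: a_def)
  \<comment> \<open>With \<open>t = 1 - 1 / m\<close>, the factor \<open>2 / (1 - t) + m\<close> is
    only \<open>3 * m\<close>, while \<open>t ^ (Suc n * m)\<close> loses no more than a factor 4
    per coordinate.\<close>
  have t: "0 < 1 - 1 / real m" "1 - 1 / real m < 1" using m2 by (auto simp: field_simps)
  have fin: "finite (a ` ?S)"
    by (rule card_int_vectors_le(1)[OF _ t _ ext T q]) (use m2 in auto)
  have "real (card (a ` ?S)) * real m ^ q * (1 - 1 / m) ^ (Suc n * m) \<le> (2 / (1 - (1 - 1 / m)) + m) ^ card {..n}"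
    by (rule card_int_vectors_le(2)[OF _ t _ ext T q]) (use m2 in auto)
  moreover have pw: "(1 - 1 / real m) ^ (Suc n * m) = ((1 - 1 / m) ^ m) ^ Suc n"
    by (simp only: mult.commute[of "Suc n"] power_mult)
  ultimately have le: "real (card (a ` ?S)) * real m ^ q * ((1 - 1 / m) ^ m) ^ Suc n \<le> (3 * real m) ^ Suc n"
    unfolding pw[symmetric] by simp
  \<comment> \<open>\<open>(1 - 1/m)^m \<ge> 1/4\<close>: Bernoulli for the exponent \<open>m/2\<close>, then squaring\<close>
  have "1 + real j * (- 1 / m) \<le> (1 + (- 1 / m)) ^ j"
    using m2 by (intro Bernoulli_inequality) (simp add: field_simps)
  then have "1 / 2 \<le> (1 - 1 / m) ^ j" using j by (simp add: m_def)
  then have "(1 / 2)\<^sup>2 \<le> ((1 - 1 / m) ^ j)\<^sup>2" by (intro power_mono) auto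
  then have "1 / 4 \<le> (1 - 1 / m) ^ m" by (simp add: m_def power_divide flip: power_mult) (simp add: mult.commute)
  then have "(1 / 4) ^ Suc n \<le> ((1 - 1 / m) ^ m) ^ Suc n" by (intro power_mono) auto
  then have "real (card (a ` ?S)) * real m ^ q * (1 / 4) ^ Suc n
      \<le> real (card (a ` ?S)) * real m ^ q * ((1 - 1 / m) ^ m) ^ Suc n"
    by (intro mult_left_mono) auto
  also note le
  finally have "real (card (a ` ?S)) * real m ^ q \<le> (3 * real m) ^ Suc n * 4 ^ Suc n"
    by (simp only: power_one_over) (simp add: field_simps)
  also have "\<dots> = (12 * real m) ^ Suc n" by (simp only: power_mult_distrib[symmetric]) (simp add: mult.commute)
  finally have card: "real (card (a ` ?S)) * real m ^ q \<le> (12 * real m) ^ Suc n" .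
  \<comment> \<open>One representative for each rounding that occurs; points with equal rounding are
    within \<open>2 / m\<close> of each other.\<close>
  define R where "R = inv_into ?S a ` a ` ?S"
  have RS: "R \<subseteq> ?S" unfolding R_def by (blast intro: inv_into_into)
  have "\<exists>r\<in>R. dist_upto n x r \<le> 2 / m" if x: "x \<in> ?S" for x
  proof
    let ?r = "inv_into ?S a (a x)"
    show "?r \<in> R" using x by (auto simp: R_def)
    have "a x = a ?r" using x by (simp add: f_inv_into_f)
    then have "trunc (x i * (m * sqrt (card {..n}))) = trunc (?r i * (m * sqrt (card {..n})))"
      if "i \<in> {..n}" for i
      using that by (metis a_def restrict_apply')
    then have "(\<Sum>i\<le>n. (x i - ?r i)\<^sup>2) \<le> (2 / m)\<^sup>2"
      using m2 by (intro trunc_scaled_eqD) auto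
    then have "(dist_upto n x ?r)\<^sup>2 \<le> (2 / m)\<^sup>2" by (simp add: dist_upto_power2)
    then show "dist_upto n x ?r \<le> 2 / m" by (rule power2_le_imp_le) simp
  qed
  moreover have "R \<subseteq> topspace (nsphere n)" using RS by (auto simp: sparse_points_def)
  moreover have "finite R" using fin by (simp add: R_def)
  moreover have "real (card R) * real m ^ q \<le> real (card (a ` ?S)) * real m ^ q"
    using card_image_le[OF fin] by (intro mult_right_mono) (auto simp: R_def)
  then have "real (card R) * real m ^ q \<le> (12 * real m) ^ Suc n" using card by linarith
  ultimately show thesis using that by blast
qed

section \<open>The map and its almost cubical image\<close>

definition clamp1 :: "real \<Rightarrow> real" where
  "clamp1 t = max (- 1) (min 1 t)"

lemma clamp1_simps:
  "\<bar>clamp1 t\<bar> \<le> 1" "1 \<le> \<bar>t\<bar> \<Longrightarrow> \<bar>clamp1 t\<bar> = 1" "clamp1 (- t) = - clamp1 t"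
  "clamp1 t = 0 \<longleftrightarrow> t = 0"
  unfolding clamp1_def by linarith+

text \<open>\<open>x i * s\<close> is cut off at 1 instead of \<open>x i\<close> at
  \<open>1 / s\<close>; the normalisation absorbs the factor. Nonzero coordinates stay nonzero, so
  the denominator is positive on the sphere.\<close>

definition spread_map :: "nat \<Rightarrow> real \<Rightarrow> (nat \<Rightarrow> real) \<Rightarrow> nat \<Rightarrow> real" where
  "spread_map n s x = (\<lambda>i. clamp1 (x i * s) / sqrt (\<Sum>j\<le>n. (clamp1 (x j * s))\<^sup>2))"

lemma spread_map_uminus: "spread_map n s (- x) = - spread_map n s x"
  by (simp add: spread_map_def fun_eq_iff clamp1_simps)

lemma sum_clamp1_pos:
  assumes "0 < s" "x \<in> topspace (nsphere n)"
  shows "0 < (\<Sum>j\<le>n. (clamp1 (x j * s))\<^sup>2)"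
proof -
  have "(\<Sum>j\<le>n. x j * x j) \<noteq> 0" using assms(2) by (simp add: mem_nsphere inner_upto_def)
  then obtain j where j: "j \<le> n" "x j \<noteq> 0"
    by (metis (no_types, lifting) atMost_iff mult_zero_left sum.neutral)
  have "0 < (clamp1 (x j * s))\<^sup>2" using j assms(1) by (simp add: clamp1_simps)
  then show ?thesis using j by (intro sum_pos2[of _ j]) auto
qed

lemma spread_map_nsphere:
  assumes "0 < s" "x \<in> topspace (nsphere n)"
  shows "spread_map n s x \<in> topspace (nsphere n)"
proof -
  let ?S = "\<Sum>j\<le>n. (clamp1 (x j * s))\<^sup>2"
  have "(\<Sum>i\<le>n. spread_map n s x i * spread_map n s x i) = (\<Sum>i\<le>n. (clamp1 (x i * s))\<^sup>2 / ?S)"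
    using sum_clamp1_pos[OF assms]
    by (intro sum.cong) (auto simp: spread_map_def power2_eq_square)
  also have "\<dots> = 1"
    using sum_clamp1_pos[OF assms] by (simp flip: sum_divide_distrib)
  finally show ?thesis
    using assms(2) by (simp add: mem_nsphere mem_Euclidean_space inner_upto_def spread_map_def clamp1_simps)
qed

text \<open>This passes to the type-class product topology, so that \<open>continuous_on\<close> and
  its rules apply.\<close>

lemma nsphere_eq_top_of_set: "nsphere n = top_of_set (topspace (nsphere n))"
proof -
  have "nsphere n = top_of_set {x. (\<Sum>i\<le>n. x i ^ 2) = 1 \<and> (\<forall>i>n. x i = 0)}"
    by (simp add: nsphere euclidean_product_topology)
  then show ?thesis by simp
qed

lemma continuous_on_spread_map:
  assumes "0 < s"
  shows "continuous_on (topspace (nsphere n)) (spread_map n s)"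
proof -
  have c: "continuous_on (topspace (nsphere n)) (\<lambda>x. clamp1 (x i * s))" for i
    unfolding clamp1_def by (intro continuous_intros continuous_on_subset[OF continuous_on_product_coordinates]) auto
  have "continuous_on (topspace (nsphere n)) (\<lambda>x. spread_map n s x i)" for i
    unfolding spread_map_def
    using sum_clamp1_pos[OF assms, of _ n] by (intro continuous_intros c) fastforce
  then show ?thesis by (intro continuous_on_coordinatewise_then_product)
qed

lemma continuous_map_spread_map:
  assumes "0 < s"
  shows "continuous_map (nsphere n) (nsphere n) (spread_map n s)"
  using continuous_on_spread_map[OF assms, of n] spread_map_nsphere[OF assms]
  by (subst (1 2) nsphere_eq_top_of_set) (auto simp: continuous_map_iff_continuous)

text \<open>Before normalisation every cut-off coordinate has absolute value 1, and all coordinates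
  have at most that, so normalising divides by at most \<open>sqrt (Suc n)\<close>.\<close>

lemma sum_abs_spread_map_ge:
  assumes "0 < s" "x \<in> topspace (nsphere n)"
  shows "real (Suc n) - card {i \<in> {..n}. \<bar>x i * s\<bar> < 1} \<le> (\<Sum>i\<le>n. \<bar>spread_map n s x i\<bar>) * sqrt (Suc n)"
proof -
  let ?S = "\<Sum>j\<le>n. (clamp1 (x j * s))\<^sup>2"
  have pos: "0 < ?S" using sum_clamp1_pos[OF assms] .
  have "?S \<le> (\<Sum>j\<le>n. 1)" by (intro sum_mono) (simp add: clamp1_simps abs_square_le_1)
  then have S: "sqrt ?S \<le> sqrt (Suc n)" by simp
  have "card {i \<in> {..n}. \<bar>x i * s\<bar> < 1} + card {i \<in> {..n}. 1 \<le> \<bar>x i * s\<bar>}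
      = card ({i \<in> {..n}. \<bar>x i * s\<bar> < 1} \<union> {i \<in> {..n}. 1 \<le> \<bar>x i * s\<bar>})"
    by (rule card_Un_disjoint[symmetric]) auto
  also have "{i \<in> {..n}. \<bar>x i * s\<bar> < 1} \<union> {i \<in> {..n}. 1 \<le> \<bar>x i * s\<bar>} = {..n}" by auto
  finally have "card {i \<in> {..n}. \<bar>x i * s\<bar> < 1} + card {i \<in> {..n}. 1 \<le> \<bar>x i * s\<bar>} = Suc n" by simp
  then have "real (Suc n) - card {i \<in> {..n}. \<bar>x i * s\<bar> < 1} = card {i \<in> {..n}. 1 \<le> \<bar>x i * s\<bar>}"
    by linarith
  also have "\<dots> = (\<Sum>i\<in>{i \<in> {..n}. 1 \<le> \<bar>x i * s\<bar>}. \<bar>clamp1 (x i * s)\<bar>)"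
    by (simp add: clamp1_simps)
  also have "\<dots> \<le> (\<Sum>i\<le>n. \<bar>clamp1 (x i * s)\<bar>)" by (intro sum_mono2) auto
  also have "\<dots> = (\<Sum>i\<le>n. \<bar>spread_map n s x i\<bar>) * sqrt ?S"
    using pos by (simp add: spread_map_def abs_divide flip: sum_divide_distrib)
  also have "\<dots> \<le> (\<Sum>i\<le>n. \<bar>spread_map n s x i\<bar>) * sqrt (Suc n)"
    using S by (intro mult_left_mono sum_nonneg) auto
  finally show ?thesis .
qed

section \<open>The l1 norm along a great circle\<close>

lemma sum_abs_diff_le_dist_upto: "(\<Sum>i\<le>n. \<bar>x i - y i\<bar>) \<le> sqrt (Suc n) * dist_upto n x y"
proof -
  have "(\<Sum>i\<le>n. \<bar>x i - y i\<bar>)\<^sup>2 \<le> (\<Sum>i\<le>n. \<bar>x i - y i\<bar>\<^sup>2) * card {..n}"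
    by (rule sum_squared_le_sum_of_squares)
  also have "\<dots> = (sqrt (Suc n) * dist_upto n x y)\<^sup>2"
    by (simp add: power_mult_distrib dist_upto_power2 mult.commute)
  finally show ?thesis by (rule power2_le_imp_le) simp
qed

text \<open>The bracket is what one coordinate contributes to the l1 norms of \<open>u\<close>,
  \<open>v\<close> and \<open>(u \<plusminus> v) / sqrt 2\<close> together. The constant 7 bounds
  \<open>(1 + sqrt 2)^2 + 1\<close>.\<close>

lemma four_directions_ineq:
  fixes a b :: real
  shows "(\<bar>a\<bar> + \<bar>b\<bar> + (\<bar>a + b\<bar> + \<bar>a - b\<bar>) / sqrt 2)\<^sup>2 \<le> 7 * (a\<^sup>2 + b\<^sup>2)"
proof -
  define M where "M = max \<bar>a\<bar> \<bar>b\<bar>"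
  define m where "m = min \<bar>a\<bar> \<bar>b\<bar>"
  have "\<bar>a + b\<bar> + \<bar>a - b\<bar> = 2 * M" unfolding M_def by linarith
  moreover have "\<bar>a\<bar> + \<bar>b\<bar> = M + m" by (simp add: M_def m_def)
  moreover have "2 * M / sqrt 2 = sqrt 2 * M"
    by (simp add: field_simps)
  ultimately have eq: "\<bar>a\<bar> + \<bar>b\<bar> + (\<bar>a + b\<bar> + \<bar>a - b\<bar>) / sqrt 2 = (1 + sqrt 2) * M + 1 * m"
    by (simp add: algebra_simps)
  have sq: "a\<^sup>2 + b\<^sup>2 = M\<^sup>2 + m\<^sup>2" by (auto simp: M_def m_def max_def min_def)
  have r: "sqrt 2 \<le> 3 / 2" by (rule real_le_lsqrt) (auto simp: power2_eq_square)
  \<comment> \<open>Cauchy--Schwarz for \<open>(1 + \<surd>2, 1)\<close> and \<open>(M, m)\<close>, as an identity\<close>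
  have "((1 + sqrt 2) * M + 1 * m)\<^sup>2 + ((1 + sqrt 2) * m - M)\<^sup>2 = ((1 + sqrt 2)\<^sup>2 + 1) * (M\<^sup>2 + m\<^sup>2)"
    by (simp add: power2_eq_square algebra_simps)
  then have "((1 + sqrt 2) * M + 1 * m)\<^sup>2 \<le> ((1 + sqrt 2)\<^sup>2 + 1) * (M\<^sup>2 + m\<^sup>2)"
    using zero_le_power2[of "(1 + sqrt 2) * m - M"] by linarith
  also have "(1 + sqrt 2)\<^sup>2 + 1 = 4 + 2 * sqrt 2" by (simp add: power2_eq_square algebra_simps)
  also have "(4 + 2 * sqrt 2) * (M\<^sup>2 + m\<^sup>2) \<le> 7 * (M\<^sup>2 + m\<^sup>2)"
    using r by (intro mult_right_mono) auto
  finally show ?thesis unfolding eq sq .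
qed

text \<open>Write \<open>N = n + 1\<close>. Otherwise every \<open>spread_map n s x\<close> has l1
  norm above \<open>0.99 * sqrt N\<close>; moving by less than \<open>1 / 50\<close> costs at most
  \<open>0.02 * sqrt N\<close>, so the l1 norm is at least \<open>0.97 * sqrt N\<close> on the whole
  circle, too much for four directions at once.\<close>

lemma ex_sparse_point_if_near_circle:
  assumes s: "0 < s" and X: "X \<subseteq> topspace (nsphere n)"
    and uv: "inner_upto n u u = 1" "inner_upto n v v = 1"
    and near: "\<And>a b. a\<^sup>2 + b\<^sup>2 = 1 \<Longrightarrow> \<exists>x\<in>X. dist_upto n (a *\<^sub>R u + b *\<^sub>R v) (spread_map n s x) < 1 / 50"
  shows "\<exists>x\<in>X. real (Suc n) \<le> 100 * card {i \<in> {..n}. \<bar>x i * s\<bar> < 1}"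
proof (rule ccontr)
  let ?N = "real (Suc n)"
  let ?r = "sqrt ?N"
  assume "\<not> ?thesis"
  then have few: "100 * card {i \<in> {..n}. \<bar>x i * s\<bar> < 1} < ?N" if "x \<in> X" for x using that by force
  have rr: "?r * ?r = ?N" "?r > 0" by auto
  have big: "97 / 100 * ?N \<le> (\<Sum>i\<le>n. \<bar>a * u i + b * v i\<bar>) * ?r" if ab: "a\<^sup>2 + b\<^sup>2 = 1" for a b
  proof -
    obtain x where x: "x \<in> X" "dist_upto n (a *\<^sub>R u + b *\<^sub>R v) (spread_map n s x) < 1 / 50"
      using near[OF ab] by blast
    have "99 / 100 * ?N \<le> (\<Sum>i\<le>n. \<bar>spread_map n s x i\<bar>) * ?r"
      using sum_abs_spread_map_ge[OF s, of x n] few[OF x(1)] X x(1) by auto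
    also have "(\<Sum>i\<le>n. \<bar>spread_map n s x i\<bar>)
        \<le> (\<Sum>i\<le>n. \<bar>a * u i + b * v i\<bar> + \<bar>a * u i + b * v i - spread_map n s x i\<bar>)"
      by (intro sum_mono) linarith
    also have "\<dots> = (\<Sum>i\<le>n. \<bar>a * u i + b * v i\<bar>) + (\<Sum>i\<le>n. \<bar>a * u i + b * v i - spread_map n s x i\<bar>)"
      by (rule sum.distrib)
    also have "(\<Sum>i\<le>n. \<bar>a * u i + b * v i - spread_map n s x i\<bar>)
        \<le> ?r * dist_upto n (a *\<^sub>R u + b *\<^sub>R v) (spread_map n s x)"
      using sum_abs_diff_le_dist_upto[of "a *\<^sub>R u + b *\<^sub>R v" "spread_map n s x" n] by simp
    also have "\<dots> \<le> ?r * (1 / 50)" using x(2) by (intro mult_left_mono) auto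
    finally have "99 / 100 * ?N \<le> ((\<Sum>i\<le>n. \<bar>a * u i + b * v i\<bar>) + ?r * (1 / 50)) * ?r"
      using rr(2) by (simp add: mult_right_mono)
    also have "\<dots> = (\<Sum>i\<le>n. \<bar>a * u i + b * v i\<bar>) * ?r + (?r * ?r) / 50"
      by (simp add: algebra_simps)
    finally show ?thesis unfolding rr(1) by linarith
  qed
  define g where "g = (\<lambda>i. \<bar>u i\<bar> + \<bar>v i\<bar> + (\<bar>u i + v i\<bar> + \<bar>u i - v i\<bar>) / sqrt 2)"
  have h: "(1 / sqrt 2)\<^sup>2 = (1 / 2 :: real)" by (simp add: power_divide)
  have half: "97 / 100 * ?N \<le> (\<Sum>i\<le>n. \<bar>u i + c * v i\<bar> / sqrt 2) * ?r" if "c = 1 \<or> c = - 1" for c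
  proof -
    have "97 / 100 * ?N \<le> (\<Sum>i\<le>n. \<bar>1 / sqrt 2 * u i + c / sqrt 2 * v i\<bar>) * ?r"
      by (rule big) (use that in \<open>auto simp: h power_divide\<close>)
    also have "(\<Sum>i\<le>n. \<bar>1 / sqrt 2 * u i + c / sqrt 2 * v i\<bar>) = (\<Sum>i\<le>n. \<bar>u i + c * v i\<bar> / sqrt 2)"
    proof (intro sum.cong refl)
      fix i
      have "1 / sqrt 2 * u i + c / sqrt 2 * v i = (u i + c * v i) / sqrt 2"
        by (simp add: add_divide_distrib)
      then show "\<bar>1 / sqrt 2 * u i + c / sqrt 2 * v i\<bar> = \<bar>u i + c * v i\<bar> / sqrt 2"
        by (simp add: abs_divide)
    qed
    finally show ?thesis .
  qed
  \<comment> \<open>The four lower bounds add up to \<open>4 * 0.97 = 3.88\<close>, but the squares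
    of \<open>g\<close> sum to at most \<open>7 * (1 + 1)\<close>, which allows only
    \<open>sqrt 14 < 3.75\<close>.\<close>
  have "388 / 100 * ?N \<le> (\<Sum>i\<le>n. g i) * ?r"
    using big[of 1 0] big[of 0 1] half[of 1] half[of "- 1"]
    by (simp add: g_def sum.distrib add_divide_distrib distrib_right)
  then have "(388 / 100 * ?N)\<^sup>2 \<le> ((\<Sum>i\<le>n. g i) * ?r)\<^sup>2" by (intro power_mono) auto
  also have "\<dots> = (\<Sum>i\<le>n. g i)\<^sup>2 * ?N" by (simp add: power_mult_distrib)
  also have "\<dots> \<le> ((\<Sum>i\<le>n. (g i)\<^sup>2) * card {..n}) * ?N"
    by (intro mult_right_mono sum_squared_le_sum_of_squares) auto
  also have "\<dots> \<le> (14 * real (card {..n})) * ?N"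
  proof (intro mult_right_mono)
    have "(\<Sum>i\<le>n. (g i)\<^sup>2) \<le> (\<Sum>i\<le>n. 7 * ((u i)\<^sup>2 + (v i)\<^sup>2))"
      unfolding g_def by (intro sum_mono four_directions_ineq)
    also have "\<dots> = 7 * (inner_upto n u u + inner_upto n v v)"
      by (simp add: inner_upto_def power2_eq_square sum.distrib flip: sum_distrib_left)
    finally show "(\<Sum>i\<le>n. (g i)\<^sup>2) \<le> 14" using uv by simp
  qed auto
  also have "\<dots> = 14 * ?N\<^sup>2" by (simp add: power2_eq_square)
  finally have "(388 / 100)\<^sup>2 * ?N\<^sup>2 \<le> 14 * ?N\<^sup>2" by (simp only: power_mult_distrib)
  then have "(388 / 100)\<^sup>2 \<le> (14 :: real)" by (rule mult_right_le_imp_le) simp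
  then show False by (simp add: power2_eq_square)
qed

lemma span_orthonormal_pair:
  assumes b: "orthonormal n 2 b"
  shows "span (b ` {..<2}) \<inter> topspace (nsphere n) = {c *\<^sub>R b 0 + d *\<^sub>R b 1 | c d. c\<^sup>2 + d\<^sup>2 = 1}"
proof -
  have inner: "inner_upto n (c *\<^sub>R b 0 + d *\<^sub>R b 1) (c *\<^sub>R b 0 + d *\<^sub>R b 1) = c\<^sup>2 + d\<^sup>2" for c d
  proof -
    have "inner_upto n (b 0) (b 0) = 1" "inner_upto n (b 1) (b 1) = 1"
      "inner_upto n (b 0) (b 1) = 0" "inner_upto n (b 1) (b 0) = 0"
      using b by (auto simp: orthonormal_def)
    then show ?thesis by (simp add: inner_upto_simps power2_eq_square)
  qed
  have "b ` {..<2} = {b 0, b 1}" by (auto simp: lessThan_Suc numeral_2_eq_2)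
  then have span: "span (b ` {..<2}) = {c *\<^sub>R b 0 + d *\<^sub>R b 1 | c d. True}"
    by (auto simp: span_insert span_singleton algebra_simps)
  have "span (b ` {..<2}) \<subseteq> topspace (Euclidean_space (Suc n))"
    using span_orthonormal_in_grassmannian[OF b] by (simp add: grassmannian_def)
  then have "c *\<^sub>R b 0 + d *\<^sub>R b 1 \<in> topspace (nsphere n) \<longleftrightarrow> c\<^sup>2 + d\<^sup>2 = 1" for c d
    unfolding mem_nsphere inner span by blast
  then show ?thesis unfolding span by blast
qed

lemma great_circle_orthonormal:
  assumes "great_circle n C"
  obtains b where "orthonormal n 2 b" "C = {c *\<^sub>R b 0 + d *\<^sub>R b 1 | c d. c\<^sup>2 + d\<^sup>2 = 1}"
proof -
  obtain V where V: "V \<in> grassmannian n 2" "C = V \<inter> topspace (nsphere n)"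
    using assms by (auto simp: great_circle_def)
  obtain b where b: "orthonormal n 2 b" "\<And>i. i < 2 \<Longrightarrow> b i \<in> V"
    "\<And>x. x \<in> V \<Longrightarrow> x = (\<Sum>i<2. inner_upto n x (b i) *\<^sub>R b i)"
    using ex_orthonormal_basis[OF V(1)] by auto
  have "C = span (b ` {..<2}) \<inter> topspace (nsphere n)"
    using V(2) span_orthonormal_basis[OF V(1) b(2,3)] by simp
  then show thesis using that[OF b(1)] span_orthonormal_pair[OF b(1)] by simp
qed

section \<open>Rotation-invariant measures on the Grassmannian\<close>

lemma continuous_on_eval2: "continuous_on UNIV (\<lambda>p :: 'a \<Rightarrow> 'b \<Rightarrow> real. p z i)"
  by (rule continuous_on_product_then_coordinatewise[OF continuous_on_product_coordinates])

lemma continuous_on_dist_upto_eval: "continuous_on UNIV (\<lambda>p. dist_upto n z (p z))"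
  unfolding dist_upto_def L2_set_def by (intro continuous_intros continuous_on_eval2)

section \<open>Closedness of the set of subspaces with a great circle near their image\<close>

lemma tendsto_apply: "(f \<longlongrightarrow> l) F \<Longrightarrow> ((\<lambda>t. f t i) \<longlongrightarrow> l i) F"
  for l :: "'a \<Rightarrow> 'b::topological_space"
  by (rule continuous_on_tendsto_compose[OF continuous_on_product_coordinates[of i]]) auto

lemma tendsto_inner_upto:
  assumes "\<And>i. ((\<lambda>t. f t i) \<longlongrightarrow> x i) F" "\<And>i. ((\<lambda>t. g t i) \<longlongrightarrow> y i) F"
  shows "((\<lambda>t. inner_upto n (f t) (g t)) \<longlongrightarrow> inner_upto n x y) F"
  unfolding inner_upto_def by (intro tendsto_intros assms)

lemma tendsto_dist_upto:
  assumes "\<And>i. ((\<lambda>t. f t i) \<longlongrightarrow> x i) F" "\<And>i. ((\<lambda>t. g t i) \<longlongrightarrow> y i) F"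
  shows "((\<lambda>t. dist_upto n (f t) (g t)) \<longlongrightarrow> dist_upto n x y) F"
  unfolding dist_upto_def L2_set_def by (intro tendsto_intros assms)

text \<open>The sphere is closed in a product of compact intervals, and
  \<open>nat \<Rightarrow> real\<close> is first countable, so compactness yields convergent
  subsequences.\<close>

lemma seq_compact_nsphere: "seq_compact (topspace (nsphere n))"
proof -
  let ?B = "PiE UNIV (\<lambda>i. if i \<le> n then {- 1..1} else {0::real})"
  have "compactin (product_topology (\<lambda>_. euclidean) UNIV) ?B"
    by (subst compactin_PiE) auto
  then have "compact ?B" by (simp add: euclidean_product_topology)
  moreover have "closed (topspace (nsphere n))"
  proof -
    have "topspace (nsphere n) = (\<Inter>i\<in>{n<..}. {x. x i = 0}) \<inter> {x. inner_upto n x x = 1}"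
      by (auto simp: mem_nsphere mem_Euclidean_space)
    moreover have "closed {x. inner_upto n x x = 1}"
      unfolding inner_upto_def by (intro closed_Collect_eq continuous_intros continuous_on_product_coordinates)
    moreover have "closed {x :: nat \<Rightarrow> real. x i = 0}" for i
      by (intro closed_Collect_eq continuous_intros continuous_on_product_coordinates)
    ultimately show ?thesis by (auto intro!: closed_INT closed_Int)
  qed
  moreover have "topspace (nsphere n) \<subseteq> ?B"
  proof
    fix x assume x: "x \<in> topspace (nsphere n)"
    have "\<bar>x i\<bar> \<le> 1" if "i \<le> n" for i
    proof -
      have "(x i)\<^sup>2 \<le> (\<Sum>i\<le>n. (x i)\<^sup>2)" using that by (intro member_le_sum) auto
      also have "\<dots> = 1" using x by (simp add: mem_nsphere inner_upto_def power2_eq_square)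
      finally show ?thesis by (simp add: abs_square_le_1)
    qed
    then show "x \<in> ?B" using x by (auto simp: mem_nsphere mem_Euclidean_space abs_le_iff minus_le_iff)
  qed
  ultimately have "compact (topspace (nsphere n))"
    by (metis compact_Int_closed inf.absorb2)
  then show ?thesis by (rule compact_imp_seq_compact)
qed

text \<open>The infimum in \<open>nbhd\<close> need not be attained, hence the strictly larger
  \<open>e\<close>.\<close>

lemma nbhdD:
  assumes "y \<in> nbhd n \<epsilon> A" "\<epsilon> < e"
  obtains a where "a \<in> A" "dist_upto n y a < e"
proof -
  have "A \<noteq> {}" "(INF a\<in>A. dist_upto n y a) < e" using assms by (auto simp: nbhd_def)
  moreover have "bdd_below (dist_upto n y ` A)" by (rule bdd_belowI[of _ 0]) auto
  ultimately show thesis using that by (auto simp: cINF_less_iff)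
qed

lemma nbhdI:
  assumes "y \<in> topspace (nsphere n)" "a \<in> A" "dist_upto n y a \<le> \<epsilon>"
  shows "y \<in> nbhd n \<epsilon> A"
proof -
  have "bdd_below (dist_upto n y ` A)" by (rule bdd_belowI[of _ 0]) auto
  then have "(INF a\<in>A. dist_upto n y a) \<le> \<epsilon>" using assms by (intro cINF_lower2)
  then show ?thesis using assms by (auto simp: nbhd_def)
qed

definition std_basis :: "nat \<Rightarrow> nat \<Rightarrow> real" where
  "std_basis j = (\<lambda>i. if i = j then 1 else 0)"

text \<open>Projections are linear, hence determined on finitely many basis vectors; this lets their
  pointwise convergence be applied at points that move with the sequence.\<close>

lemma orth_proj_eq_sum_std_basis:
  assumes V: "V \<in> grassmannian n k" "0 < k"
  shows "orth_proj n V x i = (\<Sum>j\<le>n. x j * orth_proj n V (std_basis j) i)"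
proof -
  obtain b where b: "orthonormal n k b" "\<And>i. i < k \<Longrightarrow> b i \<in> V"
    "\<And>x. x \<in> V \<Longrightarrow> x = (\<Sum>i<k. inner_upto n x (b i) *\<^sub>R b i)"
    using ex_orthonormal_basis[OF V] by metis
  have e: "inner_upto n (std_basis j) y = y j" if "j \<le> n" for j y
    using that by (simp add: inner_upto_def std_basis_def if_distrib[of "\<lambda>a. a * _"] cong: if_cong)
  have "orth_proj n V x i = (\<Sum>l<k. (\<Sum>j\<le>n. x j * b l j) * b l i)"
    by (simp add: orth_proj_orthonormal[OF V(1) b] sum_apply inner_upto_def)
  also have "\<dots> = (\<Sum>j\<le>n. \<Sum>l<k. x j * b l j * b l i)"
    by (simp add: sum_distrib_right) (rule sum.swap)
  also have "\<dots> = (\<Sum>j\<le>n. x j * orth_proj n V (std_basis j) i)"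
    by (intro sum.cong refl)
       (simp add: orth_proj_orthonormal[OF V(1) b] sum_apply e sum_distrib_left mult.assoc)
  finally show ?thesis .
qed

definition circle_near_image :: "nat \<Rightarrow> real \<Rightarrow> ((nat \<Rightarrow> real) \<Rightarrow> nat \<Rightarrow> real) \<Rightarrow> (nat \<Rightarrow> real) set \<Rightarrow> bool" where
  "circle_near_image n \<epsilon> \<psi> V \<longleftrightarrow>
     (\<exists>C. great_circle n C \<and> C \<subseteq> nbhd n \<epsilon> (\<psi> ` (V \<inter> topspace (nsphere n))))"

text \<open>Compactness: orthonormal bases of the circles subconverge to a basis of a limit circle.
  For each point \<open>w\<close> of that circle, preimages of nearby image points subconverge to
  some \<open>y\<close> in \<open>V\<close>, and continuity of \<open>\<psi>\<close> bounds the
  distance from \<open>w\<close> to \<open>\<psi> y\<close> by \<open>\<epsilon>\<close>.\<close>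

lemma circle_near_image_limit:
  assumes k: "0 < k" and cont: "continuous_on (topspace (nsphere n)) \<psi>"
    and V: "V \<in> grassmannian n k" and Vt: "\<And>t. Vt t \<in> grassmannian n k"
    and conv: "\<And>j i. (\<lambda>t. orth_proj n (Vt t) (std_basis j) i) \<longlonglongrightarrow> orth_proj n V (std_basis j) i"
    and near: "\<And>t. circle_near_image n \<epsilon> \<psi> (Vt t)"
  shows "circle_near_image n \<epsilon> \<psi> V"
proof -
  let ?S = "topspace (nsphere n)"
  have "\<exists>b. orthonormal n 2 b \<and> {c *\<^sub>R b 0 + d *\<^sub>R b 1 | c d. c\<^sup>2 + d\<^sup>2 = 1} \<subseteq> nbhd n \<epsilon> (\<psi> ` (Vt t \<inter> ?S))"
    (is "\<exists>b. ?P t b") for t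
  proof -
    obtain C where C: "great_circle n C" "C \<subseteq> nbhd n \<epsilon> (\<psi> ` (Vt t \<inter> ?S))"
      using near[of t] unfolding circle_near_image_def by blast
    show ?thesis by (rule great_circle_orthonormal[OF C(1)]) (use C(2) in blast)
  qed
  then have "\<exists>b. \<forall>t. ?P t (b t)" by (intro choice allI)
  then obtain b where bt: "\<forall>t. ?P t (b t)" ..
  have b: "orthonormal n 2 (b t)"
    "{c *\<^sub>R b t 0 + d *\<^sub>R b t 1 | c d. c\<^sup>2 + d\<^sup>2 = 1} \<subseteq> nbhd n \<epsilon> (\<psi> ` (Vt t \<inter> ?S))" for t
    by (rule conjunct1[OF spec[OF bt]], rule conjunct2[OF spec[OF bt]])
  have bS: "b t i \<in> ?S" if "i < 2" for t i
    using b(1)[of t] that by (auto simp: orthonormal_def mem_nsphere)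
  obtain u r1 where u: "u \<in> ?S" "strict_mono r1" "((\<lambda>t. b t 0) \<circ> r1) \<longlonglongrightarrow> u"
    using seq_compactE[OF seq_compact_nsphere, of "\<lambda>t. b t 0" n] bS by auto
  obtain v r2 where v: "v \<in> ?S" "strict_mono r2" "((\<lambda>t. b (r1 t) 1) \<circ> r2) \<longlonglongrightarrow> v"
    using seq_compactE[OF seq_compact_nsphere, of "\<lambda>t. b (r1 t) 1" n] bS by auto
  define r where "r = r1 \<circ> r2"
  have r: "strict_mono r" using u(2) v(2) by (simp add: r_def strict_mono_o)
  have lim0: "(\<lambda>t. b (r t) 0) \<longlonglongrightarrow> u"
    using LIMSEQ_subseq_LIMSEQ[OF u(3) v(2)] by (simp add: r_def o_def)
  have lim1: "(\<lambda>t. b (r t) 1) \<longlonglongrightarrow> v" using v(3) by (simp add: r_def o_def)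
  have "(\<lambda>t. inner_upto n (b (r t) 0) (b (r t) 1)) \<longlonglongrightarrow> inner_upto n u v"
    by (rule tendsto_inner_upto[OF tendsto_apply[OF lim0] tendsto_apply[OF lim1]])
  moreover have "inner_upto n (b (r t) 0) (b (r t) 1) = 0" for t
    using b(1)[of "r t"] by (simp add: orthonormal_def)
  ultimately have uv: "inner_upto n u v = 0" by (simp add: LIMSEQ_const_iff)
  define b' where "b' = (\<lambda>i::nat. if i = 0 then u else v)"
  have b': "orthonormal n 2 b'"
    using u(1) v(1) uv inner_upto_commute[of n u v]
    by (auto simp: orthonormal_def b'_def mem_nsphere less_2_cases_iff)
  define C where "C = {c *\<^sub>R u + d *\<^sub>R v | c d. c\<^sup>2 + d\<^sup>2 = 1}"
  have CS: "span (b' ` {..<2}) \<inter> ?S = C"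
    using span_orthonormal_pair[OF b'] by (simp add: C_def b'_def)
  then have "great_circle n C"
    unfolding great_circle_def using span_orthonormal_in_grassmannian[OF b'] by metis
  moreover have "w \<in> nbhd n \<epsilon> (\<psi> ` (V \<inter> ?S))" if wC: "w \<in> C" for w
  proof -
    obtain c d where cd: "w = c *\<^sub>R u + d *\<^sub>R v" "c\<^sup>2 + d\<^sup>2 = 1" using wC by (auto simp: C_def)
    define wt where "wt = (\<lambda>t. c *\<^sub>R b (r t) 0 + d *\<^sub>R b (r t) 1)"
    have wt: "wt t \<in> nbhd n \<epsilon> (\<psi> ` (Vt (r t) \<inter> ?S))" for t
      using b(2)[of "r t"] cd(2) by (auto simp: wt_def)
    \<comment> \<open>The slack \<open>1 / Suc t\<close> makes up for an infimum that may not be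
      attained, and disappears in the limit.\<close>
    have "\<exists>x. x \<in> Vt (r t) \<inter> ?S \<and> dist_upto n (wt t) (\<psi> x) < \<epsilon> + 1 / Suc t" for t
      by (rule nbhdD[OF wt[of t], of "\<epsilon> + 1 / Suc t"]) auto
    then obtain x where x: "\<And>t. x t \<in> Vt (r t)" "\<And>t. x t \<in> ?S"
      "\<And>t. dist_upto n (wt t) (\<psi> (x t)) < \<epsilon> + 1 / Suc t"
      by (metis IntE)
    obtain y q where y: "y \<in> ?S" "strict_mono q" "(x \<circ> q) \<longlonglongrightarrow> y"
      using seq_compactE[OF seq_compact_nsphere, of x n] x(2) by auto
    have xy: "(\<lambda>t. x (q t)) \<longlonglongrightarrow> y" using y(3) by (simp add: o_def)
    have sub: "(\<lambda>t. f (q t)) \<longlonglongrightarrow> l" if "f \<longlonglongrightarrow> l" for f :: "nat \<Rightarrow> 'a::topological_space" and l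
      using LIMSEQ_subseq_LIMSEQ[OF that y(2)] by (simp add: o_def)
    \<comment> \<open>Each \<open>x (q t)\<close> is fixed by the projection onto its own subspace;
      in the limit \<open>y\<close> is fixed by the projection onto \<open>V\<close>, which puts it
      into \<open>V\<close>.\<close>
    have "orth_proj n V y = y"
    proof
      fix i
      have "(\<lambda>t. \<Sum>j\<le>n. x (q t) j * orth_proj n (Vt (r (q t))) (std_basis j) i)
          \<longlonglongrightarrow> (\<Sum>j\<le>n. y j * orth_proj n V (std_basis j) i)"
        using LIMSEQ_subseq_LIMSEQ[OF conv strict_mono_o[OF r y(2)]]
        by (intro tendsto_intros tendsto_apply[OF xy]) (simp add: o_def)
      moreover have "(\<Sum>j\<le>n. x (q t) j * orth_proj n (Vt (r (q t))) (std_basis j) i) = x (q t) i" for t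
        using orth_proj_eq_sum_std_basis[OF Vt k, of "r (q t)" "x (q t)" i] orth_proj_of_mem[OF Vt x(1)]
        by simp
      ultimately have "(\<lambda>t. x (q t) i) \<longlonglongrightarrow> orth_proj n V y i"
        using orth_proj_eq_sum_std_basis[OF V k, of y i] by simp
      then show "orth_proj n V y i = y i"
        using tendsto_apply[OF xy] by (rule LIMSEQ_unique)
    qed
    then have yV: "y \<in> V" using orth_proj_mem[OF V k, of y] by simp
    have \<psi>xy: "(\<lambda>t. \<psi> (x (q t))) \<longlonglongrightarrow> \<psi> y"
      using x(2) y(1) by (intro continuous_on_tendsto_compose[OF cont xy]) auto
    have "(\<lambda>t. wt t i) \<longlonglongrightarrow> w i" for i
      unfolding wt_def cd(1) plus_fun_apply scaleR_fun_apply
      by (intro tendsto_intros tendsto_apply[OF lim0] tendsto_apply[OF lim1])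
    then have "(\<lambda>t. dist_upto n (wt (q t)) (\<psi> (x (q t)))) \<longlonglongrightarrow> dist_upto n w (\<psi> y)"
      by (intro tendsto_dist_upto tendsto_apply[OF \<psi>xy] sub)
    moreover have "(\<lambda>t. \<epsilon> + 1 / Suc t) \<longlonglongrightarrow> \<epsilon> + 0"
      by (intro tendsto_intros LIMSEQ_Suc[OF lim_1_over_n])
    then have "(\<lambda>t. \<epsilon> + 1 / Suc (q t)) \<longlonglongrightarrow> \<epsilon>" using sub by fastforce
    ultimately have "dist_upto n w (\<psi> y) \<le> \<epsilon>"
      using x(3) by (intro LIMSEQ_le) (auto intro: less_imp_le)
    then show ?thesis
      using wC yV y(1) CS by (intro nbhdI[of w n "\<psi> y"]) auto
  qed
  ultimately show ?thesis unfolding circle_near_image_def by blast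
qed

text \<open>
  The product topology on maps \<open>(nat \<Rightarrow> real) \<Rightarrow> nat \<Rightarrow> real\<close> is not first countable, but a projection is
  determined by its values on finitely many basis vectors, so sequences suffice.
\<close>

lemma openin_no_circle_near_image:
  assumes k: "0 < k" and cont: "continuous_on (topspace (nsphere n)) \<psi>"
  shows "openin (grassmannian_topology n k) {V \<in> grassmannian n k. \<not> circle_near_image n \<epsilon> \<psi> V}"
proof -
  define E where "E = (\<lambda>(p :: (nat \<Rightarrow> real) \<Rightarrow> nat \<Rightarrow> real) j. p (std_basis j))"
  \<comment> \<open>The closure is formed in the first countable space
    \<open>nat \<Rightarrow> nat \<Rightarrow> real\<close>, so its points are limits of sequences;
    the limit lemma shows that it captures no further subspaces.\<close>
  define K where "K = closure {E (orth_proj n V) | V. V \<in> grassmannian n k \<and> circle_near_image n \<epsilon> \<psi> V}"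
  have "continuous_on UNIV E"
    unfolding E_def
    by (intro continuous_on_coordinatewise_then_product continuous_on_eval2)
  then have op: "open (E -` (- K))" by (intro open_vimage) (auto simp: K_def)
  have "circle_near_image n \<epsilon> \<psi> V" if V: "V \<in> grassmannian n k" "E (orth_proj n V) \<in> K" for V
  proof -
    obtain f where f: "\<And>t::nat. f t \<in> {E (orth_proj n V) | V. V \<in> grassmannian n k \<and> circle_near_image n \<epsilon> \<psi> V}"
      "f \<longlonglongrightarrow> E (orth_proj n V)"
      using V(2) unfolding K_def closure_sequential by blast
    then obtain Vt where Vt: "\<And>t. f t = E (orth_proj n (Vt t))" "\<And>t. Vt t \<in> grassmannian n k"
      "\<And>t. circle_near_image n \<epsilon> \<psi> (Vt t)"
      by (simp, metis)
    have "(\<lambda>t. f t j i) \<longlonglongrightarrow> E (orth_proj n V) j i" for j i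
      by (rule tendsto_apply[OF tendsto_apply[OF f(2)]])
    then have "(\<lambda>t. orth_proj n (Vt t) (std_basis j) i) \<longlonglongrightarrow> orth_proj n V (std_basis j) i" for j i
      unfolding Vt(1) E_def .
    then show ?thesis
      by (rule circle_near_image_limit[OF k cont V(1) Vt(2) _ Vt(3)])
  qed
  moreover have "E (orth_proj n V) \<in> K" if "V \<in> grassmannian n k" "circle_near_image n \<epsilon> \<psi> V" for V
    unfolding K_def using that by (intro subsetD[OF closure_subset]) auto
  ultimately have "{V \<in> grassmannian n k. \<not> circle_near_image n \<epsilon> \<psi> V} = orth_proj n -` (E -` (- K)) \<inter> grassmannian n k"
    by auto
  then show ?thesis
    using op unfolding grassmannian_topology_def openin_pullback_topology by auto
qed

section \<open>Invariance of the probability of passing near a point\<close>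

definition near_subspaces :: "nat \<Rightarrow> nat \<Rightarrow> real \<Rightarrow> (nat \<Rightarrow> real) \<Rightarrow> (nat \<Rightarrow> real) set set" where
  "near_subspaces n k \<rho> z = {V \<in> grassmannian n k. dist_upto n z (orth_proj n V z) \<le> \<rho>}"

lemma sets_rotation_invariant_prob_openin:
  assumes "rotation_invariant_prob n k M" "openin (grassmannian_topology n k) U"
  shows "U \<in> sets M"
  using assms by (auto simp: rotation_invariant_prob_def intro: sigma_sets.Basic)

text \<open>The distance to \<open>V\<close>, written through the projection, is continuous in
  \<open>V\<close>, so the complement is open.\<close>

lemma near_subspaces_sets:
  assumes M: "rotation_invariant_prob n k M"
  shows "near_subspaces n k \<rho> z \<in> sets M"
proof -
  have "open {p :: (nat \<Rightarrow> real) \<Rightarrow> nat \<Rightarrow> real. \<rho> < dist_upto n z (p z)}"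
    by (intro open_Collect_less continuous_intros continuous_on_dist_upto_eval)
  then have "openin (grassmannian_topology n k)
      (orth_proj n -` {p. \<rho> < dist_upto n z (p z)} \<inter> grassmannian n k)"
    unfolding grassmannian_topology_def openin_pullback_topology by auto
  then have "space M - (orth_proj n -` {p. \<rho> < dist_upto n z (p z)} \<inter> grassmannian n k) \<in> sets M"
    by (intro sets.compl_sets sets_rotation_invariant_prob_openin[OF M])
  also have "space M - (orth_proj n -` {p. \<rho> < dist_upto n z (p z)} \<inter> grassmannian n k) = near_subspaces n k \<rho> z"
    using M by (auto simp: rotation_invariant_prob_def near_subspaces_def)
  finally show ?thesis .
qed

text \<open>Invariance is stated through \<open>distr\<close>, which yields measures of preimages
  only for measurable maps. On projections the reflection acts by conjugation \<open>\<Phi>\<close>,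
  which is continuous for pointwise convergence.\<close>

lemma measurable_image_reflection:
  assumes M: "rotation_invariant_prob n k M" and k: "0 < k" and w: "w \<in> topspace (nsphere n)"
  shows "(`) (reflection n w) \<in> measurable M M"
proof (rule measurable_sigma_sets)
  let ?R = "reflection n w"
  show "sets M = sigma_sets (grassmannian n k) {U. openin (grassmannian_topology n k) U}"
    using M by (simp add: rotation_invariant_prob_def)
  show "{U. openin (grassmannian_topology n k) U} \<subseteq> Pow (grassmannian n k)"
    by (auto simp: grassmannian_topology_def openin_pullback_topology)
  have sp: "space M = grassmannian n k" using M by (simp add: rotation_invariant_prob_def)
  show "(`) ?R \<in> space M \<rightarrow> grassmannian n k"
    using reflection_grassmannian(1)[OF w _ k] sp by auto
  fix A assume "A \<in> {U. openin (grassmannian_topology n k) U}"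
  then obtain U where U: "open U" "A = orth_proj n -` U \<inter> grassmannian n k"
    by (auto simp: grassmannian_topology_def openin_pullback_topology)
  define \<Phi> where "\<Phi> = (\<lambda>(p :: (nat \<Rightarrow> real) \<Rightarrow> nat \<Rightarrow> real) x. ?R (p (?R x)))"
  have "continuous_on UNIV (\<lambda>p. \<Phi> p x i)" for x i
    unfolding \<Phi>_def reflection_def[of n w "_ (?R x)"] minus_apply scaleR_fun_apply inner_upto_def
    by (intro continuous_intros continuous_on_eval2)
  then have "continuous_on UNIV \<Phi>"
    by (intro continuous_on_coordinatewise_then_product)
  then have "open (\<Phi> -` U)" using U(1) by (intro open_vimage)
  moreover have "orth_proj n (?R ` V) = \<Phi> (orth_proj n V)" if "V \<in> grassmannian n k" for V
    using reflection_grassmannian(2)[OF w that k] by (auto simp: \<Phi>_def)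
  then have "(`) ?R -` A \<inter> space M = orth_proj n -` (\<Phi> -` U) \<inter> grassmannian n k"
    using reflection_grassmannian(1)[OF w _ k] by (auto simp: U(2) sp)
  ultimately show "(`) ?R -` A \<inter> space M \<in> sets M"
    by (auto intro!: sets_rotation_invariant_prob_openin[OF M]
        simp: grassmannian_topology_def openin_pullback_topology)
qed

text \<open>A reflection taking \<open>x\<close> to \<open>y\<close> preserves distances and hence
  carries the subspaces near \<open>x\<close> to those near \<open>y\<close>.\<close>

lemma prob_near_subspaces_eq:
  assumes M: "rotation_invariant_prob n k M" and k: "0 < k"
    and xy: "x \<in> topspace (nsphere n)" "y \<in> topspace (nsphere n)"
  shows "measure M (near_subspaces n k \<rho> x) = measure M (near_subspaces n k \<rho> y)"
proof (cases "x = y")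
  case False
  then obtain w where w: "w \<in> topspace (nsphere n)" "reflection n w x = y"
    using ex_reflection_swapping xy by metis
  let ?R = "reflection n w"
  have ww: "inner_upto n w w = 1" using w(1) by (simp add: mem_nsphere)
  have Ry: "?R y = x" using w(2) reflection_reflection[OF ww] by metis
  have iff: "?R ` V \<in> near_subspaces n k \<rho> y \<longleftrightarrow> V \<in> near_subspaces n k \<rho> x"
    if V: "V \<in> grassmannian n k" for V
  proof -
    have "y - orth_proj n (?R ` V) y = ?R (x - orth_proj n V x)"
      by (simp add: reflection_grassmannian(2)[OF w(1) V k] Ry linear_diff[OF linear_reflection] w(2))
    then have "dist_upto n y (orth_proj n (?R ` V) y) = dist_upto n x (orth_proj n V x)"
      by (simp add: dist_upto_eq_sqrt_inner inner_reflection[OF ww])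
    then show ?thesis using V reflection_grassmannian(1)[OF w(1) V k] by (simp add: near_subspaces_def)
  qed
  have sp: "space M = grassmannian n k" using M by (simp add: rotation_invariant_prob_def)
  have "distr M M ((`) ?R) = M"
    using M orthogonal_upto_reflection[OF w(1)] by (simp add: rotation_invariant_prob_def)
  then have "measure M (near_subspaces n k \<rho> y) = measure (distr M M ((`) ?R)) (near_subspaces n k \<rho> y)"
    by simp
  also have "\<dots> = measure M ((`) ?R -` near_subspaces n k \<rho> y \<inter> space M)"
    by (intro measure_distr measurable_image_reflection[OF M k w(1)] near_subspaces_sets[OF M])
  also have "(`) ?R -` near_subspaces n k \<rho> y \<inter> space M = near_subspaces n k \<rho> x"
    using iff by (auto simp: sp near_subspaces_def)
  finally show ?thesis by simp
qed simp

section \<open>The probability bound\<close>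

text \<open>Double counting: by invariance the left side is the expected number of points of
  \<open>Z\<close> near \<open>V\<close>, and that number is bounded for every single
  \<open>V\<close>.\<close>

lemma card_separated_mult_prob_near_subspaces_le:
  fixes m :: nat
  assumes M: "rotation_invariant_prob n k M" and k: "0 < k" and m: "0 < m"
    and x: "x \<in> topspace (nsphere n)"
    and Z: "finite Z" "Z \<subseteq> topspace (nsphere n)"
    "\<And>x y. x \<in> Z \<Longrightarrow> y \<in> Z \<Longrightarrow> x \<noteq> y \<Longrightarrow> 7 / m \<le> dist_upto n x y"
  shows "card Z * measure M (near_subspaces n k (2 / m) x) \<le> (5 * 2 ^ m) ^ k"
proof -
  interpret prob_space M using M by (simp add: rotation_invariant_prob_def)
  let ?E = "near_subspaces n k (2 / m)"
  note [measurable] = near_subspaces_sets[OF M]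
  have "card Z * measure M (?E x) = (\<Sum>z\<in>Z. measure M (?E x))" by simp
  also have "\<dots> = (\<Sum>z\<in>Z. measure M (?E z))"
    using Z(2) by (intro sum.cong refl prob_near_subspaces_eq[OF M k x]) auto
  also have "\<dots> = (\<Sum>z\<in>Z. \<integral>V. indicator (?E z) V \<partial>M)"
    by simp
  also have "\<dots> = (\<integral>V. (\<Sum>z\<in>Z. indicator (?E z) V) \<partial>M)"
    by (subst Bochner_Integration.integral_sum) (auto intro!: integrable_real_indicator simp: less_top[symmetric])
  also have "\<dots> \<le> (5 * 2 ^ m) ^ k"
  proof (rule integral_le_const)
    show "integrable M (\<lambda>V. \<Sum>z\<in>Z. indicator (?E z) V :: real)"
      by (intro Bochner_Integration.integrable_sum integrable_real_indicator) (auto simp: less_top[symmetric])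
    show "AE V in M. (\<Sum>z\<in>Z. indicator (?E z) V) \<le> (5 * 2 ^ m :: real) ^ k"
    proof (rule AE_I2)
      fix V assume "V \<in> space M"
      then have V: "V \<in> grassmannian n k" using M by (simp add: rotation_invariant_prob_def)
      have "(\<Sum>z\<in>Z. indicator (?E z) V) = real (card {z \<in> Z. dist_upto n z (orth_proj n V z) \<le> 2 / m})"
        using Z(1) V by (simp add: indicator_def near_subspaces_def sum.If_cases Int_def)
      also have "\<dots> \<le> real ((5 * 2 ^ m) ^ k)"
        by (rule of_nat_mono, rule card_separated_near_subspace_le[OF V k m Z(1,2)]) (rule Z(3))
      finally show "(\<Sum>z\<in>Z. indicator (?E z) V) \<le> (5 * 2 ^ m :: real) ^ k" by simp
    qed
  qed
  finally show ?thesis .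
qed

text \<open>\<open>(n + 100) div 100\<close> is \<open>(n + 1) / 100\<close> rounded up. The gap
  between \<open>1 / 100\<close> and \<open>1 / 50\<close> pays for the infimum in
  \<open>nbhd\<close>.\<close>

lemma circle_near_image_ex_sparse_point:
  assumes "0 < s" "circle_near_image n (1 / 100) (spread_map n s) V"
  obtains x where "x \<in> V" "x \<in> sparse_points n s ((n + 100) div 100)"
proof -
  let ?S = "topspace (nsphere n)"
  obtain C where C: "great_circle n C" "C \<subseteq> nbhd n (1 / 100) (spread_map n s ` (V \<inter> ?S))"
    using assms(2) by (auto simp: circle_near_image_def)
  obtain b where b: "orthonormal n 2 b" "C = {c *\<^sub>R b 0 + d *\<^sub>R b 1 | c d. c\<^sup>2 + d\<^sup>2 = 1}"
    by (rule great_circle_orthonormal[OF C(1)])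
  have "\<exists>x\<in>V \<inter> ?S. real (Suc n) \<le> 100 * card {i \<in> {..n}. \<bar>x i * s\<bar> < 1}"
  proof (rule ex_sparse_point_if_near_circle[OF assms(1)])
    show "inner_upto n (b 0) (b 0) = 1" "inner_upto n (b 1) (b 1) = 1"
      using b(1) by (auto simp: orthonormal_def)
    fix c d :: real assume "c\<^sup>2 + d\<^sup>2 = 1"
    then have "c *\<^sub>R b 0 + d *\<^sub>R b 1 \<in> nbhd n (1 / 100) (spread_map n s ` (V \<inter> ?S))"
      using C(2) unfolding b(2) by blast
    then show "\<exists>x\<in>V \<inter> ?S. dist_upto n (c *\<^sub>R b 0 + d *\<^sub>R b 1) (spread_map n s x) < 1 / 50"
      by (rule nbhdD[of _ _ _ _ "1 / 50"]) auto
  qed auto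
  then obtain x where x: "x \<in> V" "x \<in> ?S" "real (Suc n) \<le> real (100 * card {i \<in> {..n}. \<bar>x i * s\<bar> < 1})"
    by auto
  from x(3) have "Suc n \<le> 100 * card {i \<in> {..n}. \<bar>x i * s\<bar> < 1}" by (simp only: of_nat_le_iff)
  then have "(n + 100) div 100 \<le> card {i \<in> {..n}. \<bar>x i * s\<bar> < 1}" by linarith
  then show thesis using that x(1,2) by (simp add: sparse_points_def)
qed

lemma prob_circle_near_image_le:
  fixes j n :: nat
  defines "m \<equiv> 2 * j"
  assumes M: "rotation_invariant_prob n k M" and k: "0 < k" and n: "0 < n" and j: "0 < j"
  shows "measure M {V \<in> grassmannian n k. circle_near_image n (1 / 100) (spread_map n (m * sqrt (Suc n))) V}
      * real m ^ ((n + 100) div 100) * (m / 320) ^ n \<le> (12 * real m) ^ Suc n * (5 * 2 ^ m) ^ k"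
proof -
  interpret prob_space M using M by (simp add: rotation_invariant_prob_def)
  let ?s = "m * sqrt (Suc n)"
  let ?q = "(n + 100) div 100"
  let ?B = "{V \<in> grassmannian n k. circle_near_image n (1 / 100) (spread_map n ?s) V}"
  let ?E = "near_subspaces n k (2 / m)"
  have m: "0 < m" using j by (simp add: m_def)
  obtain x where x: "x \<in> topspace (nsphere n)" using in_topspace_nsphere by blast
  let ?p = "measure M (?E x)"
  obtain R where R: "finite R" "R \<subseteq> topspace (nsphere n)"
    "\<And>x. x \<in> sparse_points n ?s ?q \<Longrightarrow> \<exists>r\<in>R. dist_upto n x r \<le> 2 / m"
    "real (card R) * real m ^ ?q \<le> (12 * real m) ^ Suc n"
    using ex_net_sparse_points[OF j, of n ?q] unfolding m_def by metis
  obtain Z where Z: "finite Z" "Z \<subseteq> topspace (nsphere n)"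
    "\<And>x y. x \<in> Z \<Longrightarrow> y \<in> Z \<Longrightarrow> x \<noteq> y \<Longrightarrow> 7 / m \<le> dist_upto n x y"
    "(m / 320) ^ n \<le> real (card Z)"
    using ex_separated_points[OF n m] by metis
  \<comment> \<open>\<open>V\<close> contains a sparse point, which has a net point \<open>r\<close>
    within \<open>2 / m\<close>; the projection of \<open>r\<close> is at least as close to
    \<open>r\<close>.\<close>
  have "?B \<subseteq> (\<Union>r\<in>R. ?E r)"
  proof
    fix V assume V: "V \<in> ?B"
    have "0 < ?s" using m by simp
    then obtain y where y: "y \<in> V" "y \<in> sparse_points n ?s ?q"
      using circle_near_image_ex_sparse_point V by blast
    obtain r where r: "r \<in> R" "dist_upto n y r \<le> 2 / m" using R(3)[OF y(2)] by blast
    have "dist_upto n r (orth_proj n V r) \<le> dist_upto n r y"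
      using V y(1) by (intro dist_upto_orth_proj_le[OF _ k]) auto
    then have "V \<in> ?E r" using V r(2) by (simp add: near_subspaces_def dist_upto_commute)
    then show "V \<in> (\<Union>r\<in>R. ?E r)" using r(1) by blast
  qed
  then have "measure M ?B \<le> measure M (\<Union>r\<in>R. ?E r)"
    using R(1) near_subspaces_sets[OF M] by (intro finite_measure_mono) auto
  also have "\<dots> \<le> (\<Sum>r\<in>R. measure M (?E r))"
    using R(1) near_subspaces_sets[OF M] by (intro measure_UNION_le) auto
  also have "\<dots> = (\<Sum>r\<in>R. ?p)"
    using R(2) by (intro sum.cong refl prob_near_subspaces_eq[OF M k _ x]) auto
  also have "\<dots> = card R * ?p" by simp
  finally have B: "measure M ?B \<le> card R * ?p" .
  have Z_le: "card Z * ?p \<le> (5 * 2 ^ m) ^ k"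
    by (rule card_separated_mult_prob_near_subspaces_le[OF M k m x Z(1,2)]) (rule Z(3))
  \<comment> \<open>Union bound and double counting are multiplied with all denominators
    cleared.\<close>
  have "measure M ?B * (real m ^ ?q * (m / 320) ^ n) \<le> (card R * ?p) * (real m ^ ?q * card Z)"
    using B Z(4) by (intro mult_mono mult_left_mono) auto
  also have "\<dots> = (card R * real m ^ ?q) * (card Z * ?p)" by (simp add: mult_ac)
  also have "\<dots> \<le> (12 * real m) ^ Suc n * (5 * 2 ^ m) ^ k"
    using R(4) Z_le by (intro mult_mono) auto
  finally show ?thesis by (simp add: mult.assoc)
qed

text \<open>With \<open>c = m^(1/100)\<close>, the bound grows per dimension by
  \<open>12 * m * 2 / (c * m / 320) = 7680 / c\<close>; the value \<open>c = 15360\<close> makes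
  this ratio \<open>1 / 2\<close>.\<close>

lemma prob_circle_near_image_le_geometric:
  fixes m n :: nat
  assumes m: "m = 15360 ^ 100" and n: "0 < n" and k: "k = nat \<lfloor>1 / real (m + 3) * real n\<rfloor> + 1"
    and M: "rotation_invariant_prob n k M"
  shows "measure M {V \<in> grassmannian n k. circle_near_image n (1 / 100) (spread_map n (m * sqrt (Suc n))) V}
      \<le> 12 * real m * 2 ^ (m + 3) * (1 / 2) ^ n"
proof -
  define j :: nat where "j = 7680 * 15360 ^ 99"
  define c :: real where "c = 15360"
  let ?q = "(n + 100) div 100"
  let ?P = "measure M {V \<in> grassmannian n k. circle_near_image n (1 / 100) (spread_map n (m * sqrt (Suc n))) V}"
  have "(15360::nat) ^ 100 = 15360 * 15360 ^ 99" by (simp only: power_Suc[symmetric]) simp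
  then have mj: "m = 2 * j" by (simp only: m j_def)
  have j: "0 < j" by (simp add: j_def)
  have mc: "real m = c ^ 100" by (simp only: m c_def of_nat_power of_nat_numeral)
  have c1: "1 \<le> c" by (simp add: c_def)
  have m1: "real m > 0" using c1 by (simp add: mc)
  have "0 < k" using k by simp
  have le: "?P * real m ^ ?q * (m / 320) ^ n \<le> (12 * real m) ^ Suc n * (5 * 2 ^ m) ^ k"
    unfolding mj by (rule prob_circle_near_image_le[OF M \<open>0 < k\<close> n j])
  have "n \<le> 100 * ?q" by linarith
  then have "c ^ n \<le> real m ^ ?q"
    using c1 by (simp only: mc power_mult[symmetric]) (rule power_increasing)
  then have "?P * c ^ n * (m / 320) ^ n \<le> ?P * real m ^ ?q * (m / 320) ^ n"
    by (intro mult_right_mono mult_left_mono) auto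
  also note le
  \<comment> \<open>\<open>5 \<le> 2 ^ 3\<close> bounds the base by \<open>2 ^ (m + 3)\<close>. The
    floor part of \<open>k\<close> then costs at most \<open>2 ^ n\<close>, and its summand 1 the
    constant \<open>2 ^ (m + 3)\<close>.\<close>
  also have "(5 * 2 ^ m :: real) ^ k \<le> 2 ^ (n + (m + 3))"
  proof -
    have "(5 * 2 ^ m :: real) ^ k \<le> (2 ^ (m + 3)) ^ k"
      by (intro power_mono) (auto simp: power_add)
    also have "\<dots> = 2 ^ ((m + 3) * k)" by (rule power_mult[symmetric])
    also have "(m + 3) * k \<le> n + (m + 3)"
    proof -
      define f where "f = nat \<lfloor>1 / real (m + 3) * real n\<rfloor>"
      have "real f \<le> 1 / real (m + 3) * real n" unfolding f_def by (rule of_nat_floor) simp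
      then have "real (m + 3) * real f \<le> real (m + 3) * (1 / real (m + 3) * real n)"
        by (rule mult_left_mono) simp
      also have "\<dots> = real n" by simp
      finally have "(m + 3) * f \<le> n" by (simp only: of_nat_mult[symmetric] of_nat_le_iff)
      then show ?thesis unfolding k f_def[symmetric] by (simp add: distrib_left)
    qed
    finally show ?thesis by simp
  qed
  finally have "?P * c ^ n * (m / 320) ^ n \<le> (12 * real m) ^ Suc n * 2 ^ (n + (m + 3))"
    by (simp add: mult_left_mono)
  also have "\<dots> = 12 * real m * 2 ^ (m + 3) * (12 * real m * 2) ^ n"
    by (simp only: power_Suc power_add power_mult_distrib mult_ac)
  also have "12 * real m * 2 = (1 / 2) * (c * (m / 320))" by (simp add: c_def)
  also have "\<dots> ^ n = (1 / 2) ^ n * (c ^ n * (m / 320) ^ n)" by (simp only: power_mult_distrib)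
  finally have "?P * (c ^ n * (m / 320) ^ n) \<le> 12 * real m * 2 ^ (m + 3) * (1 / 2) ^ n * (c ^ n * (m / 320) ^ n)"
    by (simp only: mult.assoc)
  then show ?thesis
    by (rule mult_right_le_imp_le) (use c1 m1 in simp)
qed

theorem theorem1p7:
  shows "\<exists>(\<alpha>::real) (\<epsilon>::real). 0 < \<alpha> \<and> \<alpha> \<le> 1 \<and> 0 < \<epsilon> \<and>
    (\<exists>\<psi> :: nat \<Rightarrow> (nat \<Rightarrow> real) \<Rightarrow> (nat \<Rightarrow> real).
       (\<forall>n\<ge>1. continuous_map (nsphere n) (nsphere n) (\<psi> n) \<and>
              (\<forall>x \<in> topspace (nsphere n). \<psi> n (- x) = - \<psi> n x)) \<and>
       (\<forall>\<mu> :: nat \<Rightarrow> (nat \<Rightarrow> real) set measure.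
          (\<forall>n\<ge>1. rotation_invariant_prob n (nat \<lfloor>\<alpha> * real n\<rfloor> + 1) (\<mu> n)) \<longrightarrow>
          (\<lambda>n. \<P>(V in \<mu> n. \<not> (\<exists>C. great_circle n C \<and>
                   C \<subseteq> nbhd n \<epsilon> (\<psi> n ` (V \<inter> topspace (nsphere n))))))
            \<longlonglongrightarrow> 1))"
proof -
  obtain m :: nat where m: "m = 15360 ^ 100" by blast
  then have m0: "0 < m" by simp
  \<comment> \<open>Chosen so that \<open>(m + 3) * \<alpha> * n = n\<close>, which keeps
    \<open>(5 * 2 ^ m) ^ k\<close> below a constant times \<open>2 ^ n\<close>.\<close>
  define \<alpha> where "\<alpha> = 1 / real (m + 3)"
  define \<psi> where "\<psi> = (\<lambda>n. spread_map n (m * sqrt (Suc n)))"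
  have s: "0 < m * sqrt (Suc n)" for n using m0 by simp
  have \<psi>: "continuous_map (nsphere n) (nsphere n) (\<psi> n)" "\<psi> n (- x) = - \<psi> n x" for n x
    unfolding \<psi>_def by (rule continuous_map_spread_map[OF s] spread_map_uminus)+
  have lim: "(\<lambda>n. \<P>(V in \<mu> n. \<not> circle_near_image n (1 / 100) (\<psi> n) V)) \<longlonglongrightarrow> 1"
    if \<mu>: "\<And>n. n \<ge> 1 \<Longrightarrow> rotation_invariant_prob n (nat \<lfloor>\<alpha> * real n\<rfloor> + 1) (\<mu> n)" for \<mu>
  proof (rule tendsto_sandwich)
    \<comment> \<open>The measures are constrained only for \<open>n \<ge> 1\<close>, so the
      sandwich holds eventually.\<close>
    have bound: "1 - 12 * real m * 2 ^ (m + 3) * (1 / 2) ^ n \<le> \<P>(V in \<mu> n. \<not> circle_near_image n (1 / 100) (\<psi> n) V)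
        \<and> \<P>(V in \<mu> n. \<not> circle_near_image n (1 / 100) (\<psi> n) V) \<le> 1" if n: "n \<ge> 1" for n
    proof -
      let ?k = "nat \<lfloor>\<alpha> * real n\<rfloor> + 1"
      let ?G = "{V \<in> grassmannian n ?k. \<not> circle_near_image n (1 / 100) (\<psi> n) V}"
      let ?B = "{V \<in> grassmannian n ?k. circle_near_image n (1 / 100) (\<psi> n) V}"
      note M = \<mu>[OF n]
      interpret prob_space "\<mu> n" using M by (simp add: rotation_invariant_prob_def)
      have sp: "space (\<mu> n) = grassmannian n ?k" using M by (simp add: rotation_invariant_prob_def)
      \<comment> \<open>\<open>measure\<close> is 0 outside \<open>sets\<close>, so the complement
        rule has to be preceded by measurability of the event, here from openness.\<close>
      have "openin (grassmannian_topology n ?k) ?G"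
        unfolding \<psi>_def by (intro openin_no_circle_near_image continuous_on_spread_map s) simp
      then have G: "?G \<in> sets (\<mu> n)" by (rule sets_rotation_invariant_prob_openin[OF M])
      have "measure (\<mu> n) (space (\<mu> n) - ?G) = 1 - measure (\<mu> n) ?G"
        by (rule prob_compl[OF G])
      moreover have "space (\<mu> n) - ?G = ?B" by (auto simp: sp)
      moreover have "measure (\<mu> n) ?B \<le> 12 * real m * 2 ^ (m + 3) * (1 / 2) ^ n"
        unfolding \<psi>_def using n by (intro prob_circle_near_image_le_geometric[OF m _ _ M]) (auto simp: \<alpha>_def)
      ultimately show ?thesis using sp by simp
    qed
    show "\<forall>\<^sub>F n in sequentially. 1 - 12 * real m * 2 ^ (m + 3) * (1 / 2) ^ n
        \<le> \<P>(V in \<mu> n. \<not> circle_near_image n (1 / 100) (\<psi> n) V)"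
      using bound by (intro eventually_sequentiallyI[of 1]) blast
    show "\<forall>\<^sub>F n in sequentially. \<P>(V in \<mu> n. \<not> circle_near_image n (1 / 100) (\<psi> n) V) \<le> 1"
      using bound by (intro eventually_sequentiallyI[of 1]) blast
    have "(\<lambda>n. 1 - 12 * real m * 2 ^ (m + 3) * (1 / 2) ^ n) \<longlonglongrightarrow> 1 - 12 * real m * 2 ^ (m + 3) * 0"
      by (intro tendsto_intros) auto
    then show "(\<lambda>n. 1 - 12 * real m * 2 ^ (m + 3) * (1 / 2) ^ n) \<longlonglongrightarrow> 1" by simp
  qed simp
  have "0 < \<alpha>" "\<alpha> \<le> 1" by (auto simp: \<alpha>_def)
  then show ?thesis
    using \<psi> lim unfolding circle_near_image_def
    by (intro exI[of _ \<alpha>] exI[of _ "1 / 100 :: real"] exI[of _ \<psi>] conjI allI impI ballI) auto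
qed

end
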